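(* Let $f:\mathbb D\to Q_2$ be a minimal Lagrangian conformal immersion with induced metric $2e^u\,\mathrm dz\,\mathrm d\bar z$ and invariants $\hat\alpha,\hat\beta$ of a normalized horizontal lift (see the context), and let $\hat u$ be a (smooth, real) function defined by $$2e^u\,\mathrm dz\,\mathrm d\bar z=\bigl(e^{\hat u}+|\hat\alpha|^2e^{-\hat u}\bigr)\mathrm dz\,\mathrm d\bar z .$$ Then $u$ satisfies $$u_{z\bar z}e^u|\hat\beta|^2-\tfrac14|\hat\alpha_z|^2e^u-|u_z|^2e^u|\hat\alpha|^2+\tfrac12\hat\alpha_zu_{\bar z}e^u\bar{\hat\alpha}+\tfrac12\bar{\hat\alpha}_{\bar z}u_ze^u\hat\alpha+2|\hat\beta|^4=0$$ if and only if $\hat u$ satisfies the elliptic sinh-Gordon equation $$\hat u_{z\bar z}+e^{\hat u}-|\hat\alpha|^2e^{-\hat u}=0 .$$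
   Context: Let $\langle \boldsymbol z,\boldsymbol w\rangle=\sum_{k=1}^4 z_kw_k$ be the complex bilinear form on $\mathbb C^4$. $\mathbb CP^3$ carries the Fubini–Study metric of constant holomorphic sectional curvature $4$, and $Q_2=\{[\boldsymbol z]\in\mathbb CP^3:\langle\boldsymbol z,\boldsymbol z\rangle=0\}$ carries the induced Kähler structure. Lagrangian means that the Kähler form pulls back to zero; minimal means that the mean curvature vector in $Q_2$ vanishes. $\mathbb D$ is a simply connected domain with conformal coordinate $z=x+iy$, $\partial_z=\frac12(\partial_x-i\partial_y)$, $\partial_{\bar z}=\frac12(\partial_x+i\partial_y)$. A horizontal lift of $f$ is a smooth map $\mathfrak f:\mathbb D\to\mathbb S^7\subset\mathbb C^4$ with $f=[\mathfrak f]$ and $\langle\mathfrak f_z,\bar{\mathfrak f}\rangle=\langle\mathfrak f_{\bar z},\bar{\mathfrak f}\rangle=0$. A normalized horizontal lift $\hat{\mathfrak f}$ is one for which $\hat\beta:=\langle\hat{\mathfrak f}_z,\hat{\mathfrak f}_{\bar z}\rangle$ is a non-negative real function; then $\hat\alpha:=\langle\hat{\mathfrak f}_z,\hat{\mathfrak f}_z\rangle$ is holomorphic and $\hat\beta=\sqrt{e^{2u}-|\hat\alpha|^2}$. The function $\hat u$ used in the paper is $\hat u=\log(e^u+\hat\beta)$, which satisfies the defining relation. *)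

theory Defs
  imports "HOL-Analysis.Analysis"
begin

section \<open>Smooth functions and Wirtinger derivatives on plane domains\<close>

definition pdir :: "complex \<Rightarrow> (complex \<Rightarrow> 'b::real_normed_vector) \<Rightarrow> complex \<Rightarrow> 'b" where
  "pdir v F z = frechet_derivative F (at z) v"

text \<open>
  The directions \<open>1\<close> and \<open>\<i>\<close> give the partial derivatives in \<open>x\<close> and \<open>y\<close>
  for \<open>z = x + \<i> y\<close>. The definitions of smoothness below are meant for open \<open>D\<close>.
\<close>

primrec ck_on :: "nat \<Rightarrow> complex set \<Rightarrow> (complex \<Rightarrow> 'b::real_normed_vector) \<Rightarrow> bool" where
  "ck_on 0 D F \<longleftrightarrow> continuous_on D F"
| "ck_on (Suc k) D F \<longleftrightarrow>
     (\<forall>z\<in>D. F differentiable (at z)) \<and> ck_on k D (pdir 1 F) \<and> ck_on k D (pdir \<i> F)"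

definition smooth_on :: "complex set \<Rightarrow> (complex \<Rightarrow> 'b::real_normed_vector) \<Rightarrow> bool" where
  "smooth_on D F \<longleftrightarrow> (\<forall>k. ck_on k D F)"

definition dz :: "(complex \<Rightarrow> complex) \<Rightarrow> complex \<Rightarrow> complex" where
  "dz g z = (pdir 1 g z - \<i> * pdir \<i> g z) / 2"

definition dzbar :: "(complex \<Rightarrow> complex) \<Rightarrow> complex \<Rightarrow> complex" where
  "dzbar g z = (pdir 1 g z + \<i> * pdir \<i> g z) / 2"

definition vdz :: "(complex \<Rightarrow> complex ^ 4) \<Rightarrow> complex \<Rightarrow> complex ^ 4" where
  "vdz F z = (\<chi> k. dz (\<lambda>w. F w $ k) z)"

definition vdzbar :: "(complex \<Rightarrow> complex ^ 4) \<Rightarrow> complex \<Rightarrow> complex ^ 4" where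
  "vdzbar F z = (\<chi> k. dzbar (\<lambda>w. F w $ k) z)"


section \<open>Complex projective space and the quadric\<close>

definition cbil :: "complex ^ 4 \<Rightarrow> complex ^ 4 \<Rightarrow> complex" where
  "cbil z w = (\<Sum>k\<in>UNIV. z $ k * w $ k)"

definition vcnj :: "complex ^ 4 \<Rightarrow> complex ^ 4" where
  "vcnj z = (\<chi> k. cnj (z $ k))"

text \<open>
  The Hermitian product of \<open>v\<close> and \<open>w\<close> is \<open>cbil v (vcnj w)\<close>; its real part is the
  library inner product \<open>v \<bullet> w\<close> of \<open>complex ^ 4\<close>.
  A point of projective space is a complex line through the origin.
\<close>

definition cline :: "complex ^ 4 \<Rightarrow> (complex ^ 4) set" where
  "cline p = vec.span {p}"

definition CP3 :: "(complex ^ 4) set set" where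
  "CP3 = {cline p | p. p \<noteq> 0}"

definition Q2 :: "(complex ^ 4) set set" where
  "Q2 = {cline p | p. p \<noteq> 0 \<and> cbil p p = 0}"


section \<open>Maps into projective space and their lifts to the unit sphere\<close>

definition local_lift ::
  "(complex \<Rightarrow> (complex ^ 4) set) \<Rightarrow> complex set \<Rightarrow> (complex \<Rightarrow> complex ^ 4) \<Rightarrow> bool" where
  "local_lift f U F \<longleftrightarrow>
     open U \<and> smooth_on U F \<and> (\<forall>z\<in>U. norm (F z) = 1 \<and> f z = cline (F z))"

text \<open>
  The Hopf fibration is a submersion with local sections, so a map into projective space is
  smooth iff it locally lifts to a smooth map into the sphere.
\<close>

definition smooth_into_CP3 :: "complex set \<Rightarrow> (complex \<Rightarrow> (complex ^ 4) set) \<Rightarrow> bool" where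
  "smooth_into_CP3 D f \<longleftrightarrow> f ` D \<subseteq> CP3 \<and> (\<forall>z\<in>D. \<exists>U F. z \<in> U \<and> U \<subseteq> D \<and> local_lift f U F)"

definition orth_proj :: "(complex ^ 4) set \<Rightarrow> complex ^ 4 \<Rightarrow> complex ^ 4" where
  "orth_proj S v = closest_point S v"

text \<open>
  The Fubini--Study metric of constant holomorphic sectional curvature 4 is the one making the
  Hopf fibration from the unit sphere a Riemannian submersion. Thus, for a unit vector \<open>p\<close>,
  the tangent space at \<open>cline p\<close> is, isometrically and complex linearly, the horizontal space
  \<open>horizontal_space p\<close>, and that of the quadric is \<open>Q2_tangent p\<close>. Replacing \<open>p\<close> by \<open>c p\<close>
  with \<open>\<bar>c\<bar> = 1\<close> replaces the representative \<open>w\<close> of a tangent vector by \<open>c w\<close>.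
\<close>

definition horizontal_space :: "complex ^ 4 \<Rightarrow> (complex ^ 4) set" where
  "horizontal_space p = {w. cbil w (vcnj p) = 0}"

definition Q2_tangent :: "complex ^ 4 \<Rightarrow> (complex ^ 4) set" where
  "Q2_tangent p = {w \<in> horizontal_space p. cbil p w = 0}"

text \<open>
  Below \<open>F\<close> is a local lift of \<open>f\<close>, not necessarily horizontal.
  \<open>lift_df F z v\<close> represents the differential of \<open>f\<close> at \<open>z\<close> applied to \<open>v\<close>. All
  representatives are multiplied by \<open>c z\<close> when \<open>F\<close> is replaced by \<open>c F\<close> with \<open>\<bar>c\<bar> = 1\<close>,
  so the conditions on \<open>f\<close> that follow do not depend on the lift.
\<close>

definition lift_df :: "(complex \<Rightarrow> complex ^ 4) \<Rightarrow> complex \<Rightarrow> complex \<Rightarrow> complex ^ 4" where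
  "lift_df F z v = orth_proj (horizontal_space (F z)) (pdir v F z)"

definition pullback_metric ::
  "(complex \<Rightarrow> complex ^ 4) \<Rightarrow> complex \<Rightarrow> complex \<Rightarrow> complex \<Rightarrow> real" where
  "pullback_metric F z v w = lift_df F z v \<bullet> lift_df F z w"

definition pullback_Kaehler_form ::
  "(complex \<Rightarrow> complex ^ 4) \<Rightarrow> complex \<Rightarrow> complex \<Rightarrow> complex \<Rightarrow> real" where
  "pullback_Kaehler_form F z v w = (\<i> *s lift_df F z v) \<bullet> lift_df F z w"

text \<open>
  \<open>covariant_derivative_Q2 F z v w\<close> represents the Levi-Civita derivative in the quadric, in
  direction \<open>v\<close>, of the field \<open>df(w)\<close> along \<open>f\<close> with constant \<open>w\<close>. In projective space,
  whose tangent space at a line \<open>L\<close> is the space of complex linear maps from \<open>L\<close> to its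
  orthogonal complement, one differentiates a representative \<open>V\<close>, projects horizontally and
  subtracts the connection term of the tautological line bundle; the latter vanishes when \<open>F\<close>
  is horizontal. The derivative in the quadric is the tangential part.
\<close>

definition covariant_derivative_Q2 ::
  "(complex \<Rightarrow> complex ^ 4) \<Rightarrow> complex \<Rightarrow> complex \<Rightarrow> complex \<Rightarrow> complex ^ 4" where
  "covariant_derivative_Q2 F z v w =
     orth_proj (Q2_tangent (F z))
       (orth_proj (horizontal_space (F z)) (pdir v (\<lambda>z'. lift_df F z' w) z)
        - cbil (pdir v F z) (vcnj (F z)) *s lift_df F z w)"

definition Q2_normal :: "(complex \<Rightarrow> complex ^ 4) \<Rightarrow> complex \<Rightarrow> (complex ^ 4) set" where
  "Q2_normal F z = {n \<in> Q2_tangent (F z). \<forall>w. n \<bullet> lift_df F z w = 0}"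

definition second_fundamental_form ::
  "(complex \<Rightarrow> complex ^ 4) \<Rightarrow> complex \<Rightarrow> complex \<Rightarrow> complex \<Rightarrow> complex ^ 4" where
  "second_fundamental_form F z v w = orth_proj (Q2_normal F z) (covariant_derivative_Q2 F z v w)"

text \<open>Half the trace with respect to the induced metric, in the coordinate basis \<open>1\<close>, \<open>\<i>\<close>.\<close>

definition mean_curvature_vector :: "(complex \<Rightarrow> complex ^ 4) \<Rightarrow> complex \<Rightarrow> complex ^ 4" where
  "mean_curvature_vector F z =
     (let g = pullback_metric F z; h = second_fundamental_form F z
      in (1 / (2 * (g 1 1 * g \<i> \<i> - (g 1 \<i>)\<^sup>2))) *\<^sub>R
           (g \<i> \<i> *\<^sub>R h 1 1 - (2 * g 1 \<i>) *\<^sub>R h 1 \<i> + g 1 1 *\<^sub>R h \<i> \<i>))"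


section \<open>Conformal, Lagrangian and minimal maps\<close>

text \<open>Here \<open>v \<bullet> w\<close>, for complex \<open>v\<close> and \<open>w\<close>, is the flat metric
  \<open>dx\<^sup>2 + dy\<^sup>2 = dz d\<bar>z\<close>.\<close>

definition conformal_immersion :: "complex set \<Rightarrow> (complex \<Rightarrow> (complex ^ 4) set) \<Rightarrow> bool" where
  "conformal_immersion D f \<longleftrightarrow> smooth_into_CP3 D f \<and>
     (\<forall>z\<in>D. \<exists>c>0. \<forall>U F. local_lift f U F \<and> z \<in> U \<longrightarrow>
        (\<forall>v w. pullback_metric F z v w = c * (v \<bullet> w)))"

definition has_induced_metric ::
  "complex set \<Rightarrow> (complex \<Rightarrow> (complex ^ 4) set) \<Rightarrow> (complex \<Rightarrow> real) \<Rightarrow> bool" where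
  "has_induced_metric D f \<rho> \<longleftrightarrow>
     (\<forall>z\<in>D. \<forall>U F. local_lift f U F \<and> z \<in> U \<longrightarrow>
        (\<forall>v w. pullback_metric F z v w = \<rho> z * (v \<bullet> w)))"

definition Lagrangian :: "complex set \<Rightarrow> (complex \<Rightarrow> (complex ^ 4) set) \<Rightarrow> bool" where
  "Lagrangian D f \<longleftrightarrow>
     (\<forall>z\<in>D. \<forall>U F. local_lift f U F \<and> z \<in> U \<longrightarrow> (\<forall>v w. pullback_Kaehler_form F z v w = 0))"

definition minimal_in_Q2 :: "complex set \<Rightarrow> (complex \<Rightarrow> (complex ^ 4) set) \<Rightarrow> bool" where
  "minimal_in_Q2 D f \<longleftrightarrow>
     (\<forall>z\<in>D. \<forall>U F. local_lift f U F \<and> z \<in> U \<longrightarrow> mean_curvature_vector F z = 0)"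


section \<open>Normalized horizontal lifts and their invariants\<close>

definition horizontal_lift ::
  "complex set \<Rightarrow> (complex \<Rightarrow> (complex ^ 4) set) \<Rightarrow> (complex \<Rightarrow> complex ^ 4) \<Rightarrow> bool" where
  "horizontal_lift D f F \<longleftrightarrow> local_lift f D F \<and>
     (\<forall>z\<in>D. cbil (vdz F z) (vcnj (F z)) = 0 \<and> cbil (vdzbar F z) (vcnj (F z)) = 0)"

definition alpha_inv :: "(complex \<Rightarrow> complex ^ 4) \<Rightarrow> complex \<Rightarrow> complex" where
  "alpha_inv F z = cbil (vdz F z) (vdz F z)"

definition beta_inv :: "(complex \<Rightarrow> complex ^ 4) \<Rightarrow> complex \<Rightarrow> complex" where
  "beta_inv F z = cbil (vdz F z) (vdzbar F z)"

definition normalized_horizontal_lift ::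
  "complex set \<Rightarrow> (complex \<Rightarrow> (complex ^ 4) set) \<Rightarrow> (complex \<Rightarrow> complex ^ 4) \<Rightarrow> bool" where
  "normalized_horizontal_lift D f F \<longleftrightarrow>
     horizontal_lift D f F \<and> (\<forall>z\<in>D. beta_inv F z \<in> \<real> \<and> 0 \<le> Re (beta_inv F z))"

end

theory Submission
  imports Defs "HOL-Complex_Analysis.Cauchy_Integral_Formula"
begin

text \<open>
  Conformality makes the tangential part of the Laplacian of a horizontal lift \<open>F\<close> vanish, and
  minimality its normal part. As \<open>F\<close>, its conjugate, \<open>F\<^sub>z\<close> and the \<open>z\<close>-bar derivative of \<open>F\<close>
  form an orthogonal basis of \<open>\<complex>\<^sup>4\<close>, expanding in it shows that \<open>\<alpha>\<close> is holomorphic and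
  that \<open>\<beta>\<^sup>2 = e\<^bsup>2u\<^esup> - \<bar>\<alpha>\<bar>\<^sup>2\<close>.
  With \<open>b = (e\<^bsup>uh\<^esup> - \<bar>\<alpha>\<bar>\<^sup>2 e\<^bsup>-uh\<^esup>) / 2 = \<plusminus>\<beta>\<close> the left-hand side of the equation for \<open>u\<close>
  is \<open>b\<^sup>3\<close> times that of the sinh-Gordon equation for \<open>uh\<close>. By continuity it remains to treat
  open sets where \<open>b\<close> vanishes; there \<open>2 uh = ln \<bar>\<alpha>\<bar>\<^sup>2\<close> is harmonic.
\<close>

section \<open>Partial derivatives\<close>

lemma pdir_eqI: "(g has_derivative g') (at z) \<Longrightarrow> pdir v g z = g' v"
  unfolding pdir_def using frechet_derivative_at by metis

lemma has_derivative_pdir: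
  "g differentiable (at z) \<Longrightarrow> (g has_derivative (\<lambda>v. pdir v g z)) (at z)"
  unfolding pdir_def by (simp add: frechet_derivative_works)

lemma pdir_expand:
  assumes "g differentiable (at z)"
  shows "pdir v g z = Re v *\<^sub>R pdir 1 g z + Im v *\<^sub>R pdir \<i> g z"
proof -
  have lin: "linear (\<lambda>v. pdir v g z)"
    using has_derivative_pdir[OF assms] has_derivative_linear by blast
  have "pdir v g z = pdir (Re v *\<^sub>R 1 + Im v *\<^sub>R \<i>) g z"
    by (simp add: complex_eq[symmetric] scaleR_conv_of_real mult.commute)
  then show ?thesis
    by (simp add: linear_add[OF lin] linear_scale[OF lin])
qed

lemma pdir_bounded_linear:
  assumes "bounded_linear T" "g differentiable (at z)"
  shows "pdir v (\<lambda>w. T (g w)) z = T (pdir v g z)"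
  by (rule pdir_eqI[OF bounded_linear.has_derivative[OF assms(1) has_derivative_pdir[OF assms(2)]]])

lemma differentiable_bounded_linear:
  fixes g :: "complex \<Rightarrow> 'b::real_normed_vector"
  assumes "bounded_linear T" "g differentiable (at z)"
  shows "(\<lambda>w. T (g w)) differentiable (at z)"
  using bounded_linear.has_derivative[OF assms(1) has_derivative_pdir[OF assms(2)]]
  by (rule differentiableI)

lemma pdir_transform:
  assumes "open D" "z \<in> D" "\<And>w. w \<in> D \<Longrightarrow> g w = h w" "h differentiable (at z)"
  shows "pdir v g z = pdir v h z"
  unfolding pdir_def
  using frechet_derivative_transform_within_open[OF assms(4,1,2), of g] assms(3) by simp

lemma pdir_inner:
  assumes "g differentiable (at z)" "h differentiable (at z)"
  shows "pdir v (\<lambda>w. g w \<bullet> h w) z = g z \<bullet> pdir v h z + pdir v g z \<bullet> h z"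
  by (rule pdir_eqI[OF has_derivative_inner[OF assms[THEN has_derivative_pdir]]])

lemma pdir_const_on:
  assumes "open D" "z \<in> D" "\<And>w. w \<in> D \<Longrightarrow> g w = c"
  shows "pdir v g z = 0"
  using assms by (subst pdir_transform[OF assms(1,2), where h = "\<lambda>_. c"]) (auto simp: pdir_def)

section \<open>Symmetry of second partial derivatives for real functions\<close>

lemma has_real_derivative_line:
  fixes g :: "complex \<Rightarrow> real"
  assumes "g differentiable (at (z + of_real s * e))"
  shows "((\<lambda>s. g (z + of_real s * e)) has_real_derivative pdir e g (z + of_real s * e)) (at s)"
proof -
  let ?z = "z + of_real s * e"
  have "((\<lambda>s. z + of_real s * e) has_derivative (\<lambda>h. of_real h * e)) (at s)"
    by (auto intro!: derivative_eq_intros)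
  then have "((\<lambda>s. g (z + of_real s * e)) has_derivative (\<lambda>h. pdir (of_real h * e) g ?z)) (at s)"
    using has_derivative_pdir[OF assms] by (rule has_derivative_compose)
  moreover have "pdir (of_real h * e) g ?z = h * pdir e g ?z" for h
    using linear_scale[OF has_derivative_linear[OF has_derivative_pdir[OF assms]], of h e]
    by (simp add: scaleR_conv_of_real)
  ultimately show ?thesis
    by (simp add: has_field_derivative_def mult.commute[of _ "pdir e g ?z"])
qed

text \<open>The mean value theorem is used twice: on \<open>\<phi>\<close>, the increment of
  \<open>g\<close> over the step \<open>t v\<close> as a function of the shift along
  \<open>e\<close>, and then on \<open>pdir e g\<close> in direction \<open>v\<close>.\<close>

lemma second_difference:
  fixes g :: "complex \<Rightarrow> real"
  assumes t: "0 < t"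
    and g: "\<And>r s. \<lbrakk>0 \<le> r; r \<le> t; 0 \<le> s; s \<le> t\<rbrakk> \<Longrightarrow>
      g differentiable (at (z + of_real r * v + of_real s * e))"
    and dg: "\<And>r s. \<lbrakk>0 \<le> r; r \<le> t; 0 \<le> s; s \<le> t\<rbrakk> \<Longrightarrow>
      pdir e g differentiable (at (z + of_real s * e + of_real r * v))"
  obtains r s where "0 < r" "r < t" "0 < s" "s < t"
    "g (z + of_real t * v + of_real t * e) - g (z + of_real t * v) - g (z + of_real t * e) + g z
      = t * t * pdir v (pdir e g) (z + of_real s * e + of_real r * v)"
proof -
  define \<phi> where "\<phi> s = g (z + of_real t * v + of_real s * e) - g (z + of_real s * e)" for s
  have "(\<phi> has_real_derivative
      pdir e g (z + of_real t * v + of_real s * e) - pdir e g (z + of_real s * e)) (at s)"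
    if "0 \<le> s" "s \<le> t" for s
    unfolding \<phi>_def
    by (intro DERIV_diff has_real_derivative_line) (use g[of t s] g[of 0 s] that t in auto)
  from MVT2[OF t this] obtain s where s: "0 < s" "s < t"
    "\<phi> t - \<phi> 0 = t * (pdir e g (z + of_real t * v + of_real s * e) - pdir e g (z + of_real s * e))"
    by auto
  have "((\<lambda>r. pdir e g (z + of_real s * e + of_real r * v)) has_real_derivative
      pdir v (pdir e g) (z + of_real s * e + of_real r * v)) (at r)" if "0 \<le> r" "r \<le> t" for r
    by (intro has_real_derivative_line) (use dg s that in auto)
  from MVT2[OF t this] obtain r where r: "0 < r" "r < t"
    "pdir e g (z + of_real s * e + of_real t * v) - pdir e g (z + of_real s * e + of_real 0 * v)
      = t * pdir v (pdir e g) (z + of_real s * e + of_real r * v)"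
    by auto
  show thesis
  proof (rule that[OF r(1,2) s(1,2)])
    have "g (z + of_real t * v + of_real t * e) - g (z + of_real t * v) - g (z + of_real t * e) + g z
        = \<phi> t - \<phi> 0"
      by (simp add: \<phi>_def)
    also have "\<dots> = t * (t * pdir v (pdir e g) (z + of_real s * e + of_real r * v))"
      using s(3) r(3) by (simp add: ac_simps)
    finally show "g (z + of_real t * v + of_real t * e) - g (z + of_real t * v)
        - g (z + of_real t * e) + g z
        = t * t * pdir v (pdir e g) (z + of_real s * e + of_real r * v)" by simp
  qed
qed

text \<open>The second difference over a small parallelogram is symmetric in \<open>v\<close> and
  \<open>e\<close>. Hence the two mixed derivatives take a common value, possibly at two different
  points near \<open>z\<close>, and continuity at \<open>z\<close> forces equality there.\<close>

lemma pdir_commute_real: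
  fixes g :: "complex \<Rightarrow> real"
  assumes D: "open D" "z \<in> D"
    and g: "\<And>w. w \<in> D \<Longrightarrow> g differentiable (at w)"
    and gv: "\<And>w. w \<in> D \<Longrightarrow> pdir v g differentiable (at w)"
    and ge: "\<And>w. w \<in> D \<Longrightarrow> pdir e g differentiable (at w)"
    and c1: "isCont (pdir v (pdir e g)) z" and c2: "isCont (pdir e (pdir v g)) z"
  shows "pdir v (pdir e g) z = pdir e (pdir v g) z"
proof (rule ccontr)
  let ?A = "pdir v (pdir e g)" and ?B = "pdir e (pdir v g)"
  assume ne: "?A z \<noteq> ?B z"
  define \<epsilon> where "\<epsilon> = \<bar>?A z - ?B z\<bar> / 2"
  have \<epsilon>: "\<epsilon> > 0" using ne by (simp add: \<epsilon>_def)
  obtain d0 where d0: "d0 > 0" "ball z d0 \<subseteq> D"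
    using D open_contains_ball by blast
  obtain d1 where d1: "d1 > 0" "\<And>w. dist w z < d1 \<Longrightarrow> dist (?A w) (?A z) < \<epsilon>"
    using c1 \<epsilon> unfolding continuous_at_eps_delta by metis
  obtain d2 where d2: "d2 > 0" "\<And>w. dist w z < d2 \<Longrightarrow> dist (?B w) (?B z) < \<epsilon>"
    using c2 \<epsilon> unfolding continuous_at_eps_delta by metis
  define d where "d = min d0 (min d1 d2)"
  have d: "d > 0" "d \<le> d0" "d \<le> d1" "d \<le> d2"
    using d0 d1 d2 by (auto simp: d_def)
  \<comment> \<open>The parallelogram spanned by \<open>t v\<close> and \<open>t e\<close> then
    stays within \<open>d\<close> of \<open>z\<close>; the \<open>+ 1\<close> keeps the denominator
    positive and the bound strict.\<close>
  define t where "t = d / (norm v + norm e + 1)"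
  have den: "norm v + norm e + 1 > 0"
    by (simp add: add_nonneg_pos)
  have t: "t > 0" using d den by (simp add: t_def)
  have small: "norm (of_real r * v + of_real s * e) < d"
    if "0 \<le> r" "r \<le> t" "0 \<le> s" "s \<le> t" for r s
  proof -
    have "norm (of_real r * v + of_real s * e) \<le> r * norm v + s * norm e"
      using norm_triangle_ineq[of "of_real r * v" "of_real s * e"] that by (simp add: norm_mult)
    also have "\<dots> \<le> t * norm v + t * norm e"
      using that by (intro add_mono mult_right_mono) auto
    also have "\<dots> < t * (norm v + norm e + 1)"
      using t by (simp add: algebra_simps)
    also have "\<dots> = d" using den by (simp add: t_def)
    finally show ?thesis .
  qed
  have near: "dist (z + of_real r * v + of_real s * e) z < d"
      "dist (z + of_real s * e + of_real r * v) z < d"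
    if "0 \<le> r" "r \<le> t" "0 \<le> s" "s \<le> t" for r s
    using small[OF that] by (simp_all add: dist_norm algebra_simps)
  have inD: "w \<in> D" if "dist w z < d" for w
    using that d0 d by (auto simp: dist_commute)
  have hg: "g differentiable (at (z + of_real r * v + of_real s * e))"
      "g differentiable (at (z + of_real s * e + of_real r * v))"
    and he: "pdir e g differentiable (at (z + of_real s * e + of_real r * v))"
    and hv: "pdir v g differentiable (at (z + of_real r * v + of_real s * e))"
    if "0 \<le> r" "r \<le> t" "0 \<le> s" "s \<le> t" for r s
    using near[OF that] g ge gv inD by blast+
  obtain r s where 1: "0 < r" "r < t" "0 < s" "s < t"
    "g (z + of_real t * v + of_real t * e) - g (z + of_real t * v) - g (z + of_real t * e) + g z
      = t * t * ?A (z + of_real s * e + of_real r * v)"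
    using second_difference[of t g z v e] t hg(1) he by blast
  obtain r' s' where 2: "0 < r'" "r' < t" "0 < s'" "s' < t"
    "g (z + of_real t * e + of_real t * v) - g (z + of_real t * e) - g (z + of_real t * v) + g z
      = t * t * ?B (z + of_real s' * v + of_real r' * e)"
    using second_difference[of t g z e v] t hg(2) hv by blast
  have "t * t * ?A (z + of_real s * e + of_real r * v) = t * t * ?B (z + of_real s' * v + of_real r' * e)"
    using 1(5) 2(5) by (simp add: algebra_simps)
  then have "?A (z + of_real s * e + of_real r * v) = ?B (z + of_real s' * v + of_real r' * e)"
    using t by simp
  moreover have "dist (?A (z + of_real s * e + of_real r * v)) (?A z) < \<epsilon>"
    using near(2)[of r s] 1 d by (intro d1) auto
  moreover have "dist (?B (z + of_real s' * v + of_real r' * e)) (?B z) < \<epsilon>"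
    using near(1)[of s' r'] 2 d by (intro d2) auto
  ultimately show False
    unfolding \<epsilon>_def dist_real_def by (smt (verit) field_sum_of_halves)
qed

section \<open>Closure properties of smooth functions\<close>

text \<open>\<open>ck_on\<close> recurses into \<open>pdir\<close>, while identities between
  derivatives are available on \<open>D\<close> only. As \<open>D\<close> is open, derivatives at
  its points depend only on values in \<open>D\<close>, so such identities suffice.\<close>

lemma ck_on_cong:
  assumes "open D" "\<And>z. z \<in> D \<Longrightarrow> g z = h z" "ck_on k D g"
  shows "ck_on k D h"
  using assms(2,3)
proof (induction k arbitrary: g h)
  case 0
  then show ?case using continuous_on_cong by force
next
  case (Suc k)
  have "(h has_derivative (\<lambda>v. pdir v g z)) (at z)" if "z \<in> D" for z
    using has_derivative_transform_within_open[OF has_derivative_pdir assms(1) that] Suc.prems that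
    by auto
  then have h: "h differentiable (at z)" "pdir v g z = pdir v h z" if "z \<in> D" for z v
    using differentiableI that pdir_eqI[of h "\<lambda>v. pdir v g z" z v] by auto
  then show ?case
    using Suc.IH[of "pdir 1 g" "pdir 1 h"] Suc.IH[of "pdir \<i> g" "pdir \<i> h"] Suc.prems(2) by auto
qed

lemma ck_on_bounded_linear:
  assumes "open D" "bounded_linear T" "ck_on k D g"
  shows "ck_on k D (\<lambda>z. T (g z))"
  using assms(3)
proof (induction k arbitrary: g)
  case 0
  then show ?case using bounded_linear.continuous_on[OF assms(2)] by simp
next
  case (Suc k)
  then have g: "g differentiable (at z)" if "z \<in> D" for z using that by simp
  have "ck_on k D (pdir v (\<lambda>z. T (g z)))" if "ck_on k D (pdir v g)" for v
    by (rule ck_on_cong[OF assms(1) _ Suc.IH[OF that]])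
      (simp add: pdir_bounded_linear[OF assms(2) g])
  then show ?case
    using Suc.prems differentiable_bounded_linear[OF assms(2) g] by simp
qed

lemma ck_on_add:
  assumes "open D" "ck_on k D g" "ck_on k D h"
  shows "ck_on k D (\<lambda>z. g z + h z)"
  using assms(2,3)
proof (induction k arbitrary: g h)
  case 0
  then show ?case by (simp add: continuous_on_add)
next
  case (Suc k)
  have "((\<lambda>z. g z + h z) has_derivative (\<lambda>v. pdir v g z + pdir v h z)) (at z)" if "z \<in> D" for z
    using Suc.prems that by (intro has_derivative_add has_derivative_pdir) auto
  then have gh: "(\<lambda>z. g z + h z) differentiable (at z)"
      "pdir v g z + pdir v h z = pdir v (\<lambda>z. g z + h z) z" if "z \<in> D" for z v
    using differentiableI that
      pdir_eqI[of "\<lambda>z. g z + h z" "\<lambda>v. pdir v g z + pdir v h z" z v] by auto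
  have "ck_on k D (pdir v (\<lambda>z. g z + h z))" if "ck_on k D (pdir v g)" "ck_on k D (pdir v h)" for v
    by (rule ck_on_cong[OF assms(1) _ Suc.IH[OF that]]) (simp add: gh)
  then show ?case
    using Suc.prems gh by simp
qed

lemma smooth_onD:
  assumes "smooth_on D g"
  shows "continuous_on D g" "z \<in> D \<Longrightarrow> g differentiable (at z)"
    "smooth_on D (pdir 1 g)" "smooth_on D (pdir \<i> g)"
proof -
  have "ck_on k D g" for k using assms by (simp add: smooth_on_def)
  from this[of 0] this[of "Suc 0"] this[of "Suc _"] show "continuous_on D g"
    "z \<in> D \<Longrightarrow> g differentiable (at z)" "smooth_on D (pdir 1 g)" "smooth_on D (pdir \<i> g)"
    by (simp_all add: smooth_on_def)
qed

lemma smooth_on_bounded_linear: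
  "open D \<Longrightarrow> bounded_linear T \<Longrightarrow> smooth_on D g \<Longrightarrow> smooth_on D (\<lambda>z. T (g z))"
  by (simp add: smooth_on_def ck_on_bounded_linear)

lemma smooth_on_add:
  "open D \<Longrightarrow> smooth_on D g \<Longrightarrow> smooth_on D h \<Longrightarrow> smooth_on D (\<lambda>z. g z + h z)"
  by (simp add: smooth_on_def ck_on_add)

lemma smooth_on_mult_left:
  fixes g :: "complex \<Rightarrow> complex"
  shows "open D \<Longrightarrow> smooth_on D g \<Longrightarrow> smooth_on D (\<lambda>z. c * g z)"
  by (rule smooth_on_bounded_linear[OF _ bounded_linear_mult_right])

lemma pdir_pdir_bounded_linear:
  assumes "open D" "z \<in> D" "bounded_linear T" "\<And>w. w \<in> D \<Longrightarrow> g differentiable (at w)"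
    "pdir e g differentiable (at z)"
  shows "pdir v (pdir e (\<lambda>w. T (g w))) z = T (pdir v (pdir e g) z)"
  using pdir_transform[OF assms(1,2) pdir_bounded_linear[OF assms(3,4)]
      differentiable_bounded_linear[OF assms(3,5)]]
    pdir_bounded_linear[OF assms(3,5)] by simp

text \<open>Pairing with a fixed vector \<open>b\<close> is bounded linear and reduces the claim to
  real functions; a vector is determined by its inner products.\<close>

lemma pdir_commute:
  fixes g :: "complex \<Rightarrow> 'b::real_inner"
  assumes D: "open D" "z \<in> D" and g: "smooth_on D g"
  shows "pdir 1 (pdir \<i> g) z = pdir \<i> (pdir 1 g) z"
proof -
  have "pdir 1 (pdir \<i> g) z \<bullet> b = pdir \<i> (pdir 1 g) z \<bullet> b" for b
  proof -
    note T = bounded_linear_inner_left[of b]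
    have s: "smooth_on D (\<lambda>w. g w \<bullet> b)"
      by (rule smooth_on_bounded_linear[OF D(1) T g])
    have "isCont h z" if "smooth_on D h" for h :: "complex \<Rightarrow> real"
      using smooth_onD(1)[OF that] D continuous_on_eq_continuous_at by blast
    then have "pdir 1 (pdir \<i> (\<lambda>w. g w \<bullet> b)) z = pdir \<i> (pdir 1 (\<lambda>w. g w \<bullet> b)) z"
      using s by (intro pdir_commute_real[OF D]) (auto intro: smooth_onD)
    then show ?thesis
      using pdir_pdir_bounded_linear[OF D T smooth_onD(2)[OF g]]
        smooth_onD(2)[OF smooth_onD(3)[OF g] D(2)] smooth_onD(2)[OF smooth_onD(4)[OF g] D(2)] by simp
  qed
  then show ?thesis
    by (metis vector_eq_rdot)
qed

section \<open>Wirtinger derivatives\<close>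

text \<open>The differential in the form p dz + q d(z-bar). Bundling differentiability with both
  coefficients gives rules that chain by resolution.\<close>

definition has_wirtinger :: "(complex \<Rightarrow> complex) \<Rightarrow> complex \<Rightarrow> complex \<Rightarrow> complex \<Rightarrow> bool" where
  "has_wirtinger g p q z \<longleftrightarrow> (g has_derivative (\<lambda>h. p * h + q * cnj h)) (at z)"

lemma has_wirtinger_imp:
  assumes "has_wirtinger g p q z"
  shows "dz g z = p" "dzbar g z = q"
  using assms unfolding has_wirtinger_def dz_def dzbar_def
  by (simp_all add: pdir_eqI algebra_simps)

text \<open>Every real-linear map of the plane has the form \<open>p * h + q * cnj h\<close>, with
  coefficients read off from its values at \<open>1\<close> and \<open>\<i>\<close>.\<close>

lemma has_wirtinger_dz_dzbar:
  assumes "g differentiable (at z)"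
  shows "has_wirtinger g (dz g z) (dzbar g z) z"
proof -
  have "(\<lambda>v. pdir v g z) = (\<lambda>h. dz g z * h + dzbar g z * cnj h)"
  proof
    fix h
    show "pdir h g z = dz g z * h + dzbar g z * cnj h"
      unfolding pdir_expand[OF assms, of h]
      by (subst (3 4) complex_eq)
        (simp add: dz_def dzbar_def scaleR_conv_of_real field_simps)
  qed
  then show ?thesis
    using has_derivative_pdir[OF assms] by (simp add: has_wirtinger_def)
qed

lemma has_wirtinger_differentiable: "has_wirtinger g p q z \<Longrightarrow> g differentiable (at z)"
  unfolding has_wirtinger_def by (rule differentiableI)

lemma has_wirtinger_eq_rhs:
  "has_wirtinger g p q z \<Longrightarrow> p = p' \<Longrightarrow> q = q' \<Longrightarrow> has_wirtinger g p' q' z"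
  by simp

lemma has_wirtinger_const: "has_wirtinger (\<lambda>_. c) 0 0 z"
  by (simp add: has_wirtinger_def)

lemma has_wirtinger_add:
  "has_wirtinger g p q z \<Longrightarrow> has_wirtinger h p' q' z \<Longrightarrow>
    has_wirtinger (\<lambda>w. g w + h w) (p + p') (q + q') z"
  unfolding has_wirtinger_def by (auto intro!: derivative_eq_intros simp: algebra_simps)

lemma has_wirtinger_diff:
  "has_wirtinger g p q z \<Longrightarrow> has_wirtinger h p' q' z \<Longrightarrow>
    has_wirtinger (\<lambda>w. g w - h w) (p - p') (q - q') z"
  unfolding has_wirtinger_def by (auto intro!: derivative_eq_intros simp: algebra_simps)

lemma has_wirtinger_mult:
  "has_wirtinger g p q z \<Longrightarrow> has_wirtinger h p' q' z \<Longrightarrow>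
    has_wirtinger (\<lambda>w. g w * h w) (p * h z + g z * p') (q * h z + g z * q') z"
  unfolding has_wirtinger_def by (auto intro!: derivative_eq_intros simp: algebra_simps)

lemma has_wirtinger_sum:
  assumes "\<And>k. k \<in> S \<Longrightarrow> has_wirtinger (g k) (p k) (q k) z"
  shows "has_wirtinger (\<lambda>w. \<Sum>k\<in>S. g k w) (\<Sum>k\<in>S. p k) (\<Sum>k\<in>S. q k) z"
proof -
  have "((\<lambda>w. \<Sum>k\<in>S. g k w) has_derivative (\<lambda>h. \<Sum>k\<in>S. p k * h + q k * cnj h)) (at z)"
    using assms unfolding has_wirtinger_def by (rule has_derivative_sum)
  then show ?thesis
    by (simp add: has_wirtinger_def sum.distrib sum_distrib_right)
qed

lemma has_wirtinger_cnj:
  "has_wirtinger g p q z \<Longrightarrow> has_wirtinger (\<lambda>w. cnj (g w)) (cnj q) (cnj p) z"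
  unfolding has_wirtinger_def
  using bounded_linear.has_derivative[OF bounded_linear_cnj] by (fastforce simp: add.commute)

text \<open>The differential of the outer map is complex linear, so it multiplies both coefficients
  by the same number.\<close>

lemma has_wirtinger_compose_holomorphic:
  assumes "has_wirtinger g p q z" "(h has_field_derivative h') (at (g z))"
  shows "has_wirtinger (\<lambda>w. h (g w)) (h' * p) (h' * q) z"
  using has_derivative_compose[OF assms[unfolded has_wirtinger_def has_field_derivative_def]]
  by (simp add: has_wirtinger_def distrib_left mult.assoc)

lemma has_wirtinger_exp:
  "has_wirtinger g p q z \<Longrightarrow> has_wirtinger (\<lambda>w. exp (g w)) (exp (g z) * p) (exp (g z) * q) z"
  by (rule has_wirtinger_compose_holomorphic) (auto intro: DERIV_exp)

lemma has_wirtinger_holomorphic: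
  assumes "g holomorphic_on D" "open D" "z \<in> D"
  shows "has_wirtinger g (deriv g z) 0 z"
  using holomorphic_derivI[OF assms] by (simp add: has_wirtinger_def has_field_derivative_def)

text \<open>These are the Cauchy-Riemann equations: without the \<open>cnj h\<close> term the
  differential is complex linear.\<close>

lemma holomorphic_on_dzbar_zero:
  assumes "\<And>z. z \<in> D \<Longrightarrow> g differentiable (at z)" "\<And>z. z \<in> D \<Longrightarrow> dzbar g z = 0"
  shows "g holomorphic_on D"
proof (rule holomorphic_onI)
  fix z assume z: "z \<in> D"
  have "(g has_field_derivative dz g z) (at z)"
    using has_wirtinger_dz_dzbar[OF assms(1)[OF z]] assms(2)[OF z]
    by (simp add: has_wirtinger_def has_field_derivative_def)
  then show "g field_differentiable (at z within D)"
    using field_differentiable_at_within field_differentiable_def by blast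
qed

lemma has_wirtinger_transform:
  assumes "has_wirtinger g p q z" "open D" "z \<in> D" "\<And>w. w \<in> D \<Longrightarrow> g w = h w"
  shows "has_wirtinger h p q z"
  using assms unfolding has_wirtinger_def by (rule has_derivative_transform_within_open)

lemma has_wirtinger_unique:
  assumes "has_wirtinger g p q z" "has_wirtinger g p' q' z"
  shows "p = p'" "q = q'"
  using has_wirtinger_imp[OF assms(1)] has_wirtinger_imp[OF assms(2)] by auto

lemma dzbar_of_real: "g differentiable (at z) \<Longrightarrow>
    dzbar (\<lambda>w. complex_of_real (g w)) z = cnj (dz (\<lambda>w. complex_of_real (g w)) z)"
  by (simp add: dz_def dzbar_def pdir_bounded_linear[OF bounded_linear_of_real])

lemma smooth_on_dz:
  assumes "open D" "smooth_on D g"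
  shows "smooth_on D (dz g)"
proof -
  have "dz g = (\<lambda>z. (1/2) * pdir 1 g z + (- \<i>/2) * pdir \<i> g z)"
    by (simp add: fun_eq_iff dz_def field_simps)
  then show ?thesis
    by (simp only:)
      (intro smooth_on_add smooth_on_mult_left assms(1) smooth_onD(3,4)[OF assms(2)])
qed

lemma smooth_on_dzbar:
  assumes "open D" "smooth_on D g"
  shows "smooth_on D (dzbar g)"
proof -
  have "dzbar g = (\<lambda>z. (1/2) * pdir 1 g z + (\<i>/2) * pdir \<i> g z)"
    by (simp add: fun_eq_iff dzbar_def field_simps)
  then show ?thesis
    by (simp only:)
      (intro smooth_on_add smooth_on_mult_left assms(1) smooth_onD(3,4)[OF assms(2)])
qed

text \<open>In the product of the two first-order operators the mixed terms cancel by symmetry of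
  second derivatives.\<close>

lemma dzbar_dz_eq_Laplacian:
  assumes D: "open D" "z \<in> D" and g: "smooth_on D g"
  shows "dzbar (dz g) z = (pdir 1 (pdir 1 g) z + pdir \<i> (pdir \<i> g) z) / 4"
proof -
  have "pdir v (dz g) z = (pdir v (pdir 1 g) z - \<i> * pdir v (pdir \<i> g) z) / 2" for v
    unfolding dz_def[abs_def]
    by (rule pdir_eqI)
      (auto intro!: derivative_eq_intros has_derivative_pdir smooth_onD(2)[OF smooth_onD(3)[OF g] D(2)]
        smooth_onD(2)[OF smooth_onD(4)[OF g] D(2)])
  note eq = this[of 1] this[of \<i>]
  show ?thesis
    unfolding dzbar_def eq using pdir_commute[OF D g] by (simp add: field_simps)
qed

section \<open>Hermitian linear algebra\<close>

lemma cbil_commute: "cbil v w = cbil w v"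
  by (simp add: cbil_def mult.commute)

lemma cbil_add_left: "cbil (v + v') w = cbil v w + cbil v' w"
  by (simp add: cbil_def sum.distrib algebra_simps)

lemma cbil_add_right: "cbil v (w + w') = cbil v w + cbil v w'"
  by (simp add: cbil_def sum.distrib algebra_simps)

lemma cbil_diff_left: "cbil (v - v') w = cbil v w - cbil v' w"
  by (simp add: cbil_def sum_subtractf algebra_simps)

lemma cbil_diff_right: "cbil v (w - w') = cbil v w - cbil v w'"
  by (simp add: cbil_def sum_subtractf algebra_simps)

lemma cbil_scale_left: "cbil (c *s v) w = c * cbil v w"
  by (simp add: cbil_def sum_distrib_left algebra_simps)

lemma cbil_scale_right: "cbil v (c *s w) = c * cbil v w"
  by (simp add: cbil_def sum_distrib_left algebra_simps)

lemma vcnj_add: "vcnj (v + w) = vcnj v + vcnj w"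
  by (simp add: vcnj_def vec_eq_iff)

lemma vcnj_diff: "vcnj (v - w) = vcnj v - vcnj w"
  by (simp add: vcnj_def vec_eq_iff)

lemma vcnj_scale: "vcnj (c *s v) = cnj c *s vcnj v"
  by (simp add: vcnj_def vec_eq_iff)

lemma vcnj_vcnj: "vcnj (vcnj v) = v"
  by (simp add: vcnj_def vec_eq_iff)

lemmas cbil_linear = cbil_add_left cbil_add_right cbil_diff_left cbil_diff_right
  cbil_scale_left cbil_scale_right vcnj_add vcnj_diff vcnj_scale

lemma cnj_cbil: "cnj (cbil v w) = cbil (vcnj v) (vcnj w)"
  by (simp add: cbil_def vcnj_def)

lemma cbil_vcnj_commute: "cbil v (vcnj w) = cnj (cbil w (vcnj v))"
  by (simp add: cnj_cbil vcnj_vcnj cbil_commute)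

lemma scaleR_eq_scale: "r *\<^sub>R (v :: complex ^ 4) = complex_of_real r *s v"
  by (simp add: vec_eq_iff complex_eq_iff)

text \<open>The real part is the metric and the imaginary part is minus the Kaehler form, so
  conformality and the Lagrangian condition merge into one Hermitian identity.\<close>

lemma cbil_vcnj_eq_Complex: "cbil v (vcnj w) = Complex (v \<bullet> w) (- ((\<i> *s v) \<bullet> w))"
  by (simp add: complex_eq_iff cbil_def vcnj_def inner_vec_def inner_complex_def sum_negf[symmetric]
      del: sum_negf)

lemma bounded_bilinear_cbil: "bounded_bilinear cbil"
  unfolding bilinear_conv_bounded_bilinear[symmetric] bilinear_def
  by (auto intro!: linearI simp: cbil_linear scaleR_eq_scale scaleR_conv_of_real)

section \<open>Expansion in Hermitian orthogonal frames\<close>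

text \<open>A matrix with orthogonal rows has its rescaled conjugate transpose \<open>B\<close> as
  right inverse. For square matrices this is also a left inverse, and pairing
  \<open>y = B *v (e *v y)\<close> with \<open>x\<close> gives the expansion.\<close>

lemma orthogonal_basis_expansion:
  fixes e :: "complex ^ 4 ^ 4" and c :: "complex ^ 4"
  assumes orth: "\<And>i j. cbil (e $ i) (vcnj (e $ j)) = (if i = j then c $ j else 0)"
    and c: "\<And>j. c $ j \<noteq> 0"
  shows "cbil x y = (\<Sum>j\<in>UNIV. cbil x (vcnj (e $ j)) * cbil (e $ j) y / c $ j)"
proof -
  define B :: "complex ^ 4 ^ 4" where "B = (\<chi> i j. cnj (e $ j $ i) / c $ j)"
  have "e ** B = mat 1"
  proof -
    have "(e ** B) $ i $ j = cbil (e $ i) (vcnj (e $ j)) / c $ j" for i j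
      by (simp add: matrix_matrix_mult_def B_def cbil_def vcnj_def sum_divide_distrib)
    then show ?thesis
      by (simp add: vec_eq_iff mat_def orth c)
  qed
  then have "B ** e = mat 1"
    by (simp add: matrix_left_right_inverse)
  then have "y = B *v (e *v y)"
    by (simp add: matrix_vector_mul_assoc)
  then have "cbil x y = cbil x (B *v (e *v y))"
    by simp
  also have "\<dots> = (\<Sum>k\<in>UNIV. \<Sum>j\<in>UNIV. x $ k * (cnj (e $ j $ k) / c $ j * cbil (e $ j) y))"
    by (simp add: cbil_def matrix_vector_mult_def B_def sum_distrib_left)
  also have "\<dots> = (\<Sum>j\<in>UNIV. \<Sum>k\<in>UNIV. x $ k * (cnj (e $ j $ k) / c $ j * cbil (e $ j) y))"
    by (rule sum.swap)
  also have "\<dots> = (\<Sum>j\<in>UNIV. cbil x (vcnj (e $ j)) * cbil (e $ j) y / c $ j)"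
    by (intro sum.cong refl)
      (simp add: cbil_def[of x] vcnj_def sum_distrib_left sum_distrib_right sum_divide_distrib mult_ac)
  finally show ?thesis .
qed

text \<open>The vectors \<open>p\<close>, \<open>vcnj p\<close>, \<open>X\<close>, \<open>Y\<close>
  are Hermitian orthogonal: \<open>cbil p p = 0\<close> separates \<open>p\<close> from its
  conjugate, and \<open>cbil X p = cbil Y p = 0\<close> separates \<open>X\<close> and
  \<open>Y\<close> from \<open>vcnj p\<close>.\<close>

lemma quadric_frame_expansion:
  assumes p: "cbil p (vcnj p) = 1" "cbil p p = 0"
    and X: "cbil X (vcnj p) = 0" "cbil X p = 0" "cbil X (vcnj X) = m"
    and Y: "cbil Y (vcnj p) = 0" "cbil Y p = 0" "cbil Y (vcnj Y) = m"
    and XY: "cbil X (vcnj Y) = 0" and m: "m \<noteq> 0"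
  shows "cbil x y = cbil x (vcnj p) * cbil p y + cbil x p * cbil (vcnj p) y
    + (cbil x (vcnj X) * cbil X y + cbil x (vcnj Y) * cbil Y y) / m"
proof -
  define e :: "complex ^ 4 ^ 4" where
    "e = (\<chi> i. if i = 1 then p else if i = 2 then vcnj p else if i = 3 then X else Y)"
  define c :: "complex ^ 4" where "c = (\<chi> i. if i = 1 \<or> i = 2 then 1 else m)"
  have e: "e $ 1 = p" "e $ 2 = vcnj p" "e $ 3 = X" "e $ 4 = Y"
    and c: "c $ 1 = 1" "c $ 2 = 1" "c $ 3 = m" "c $ 4 = m"
    by (simp_all add: e_def c_def)
  have X': "cbil p (vcnj X) = 0" "cbil (vcnj p) (vcnj X) = 0" "cbil Y (vcnj X) = 0"
    and Y': "cbil p (vcnj Y) = 0" "cbil (vcnj p) (vcnj Y) = 0"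
    and p': "cbil (vcnj p) (vcnj p) = 0" "cbil (vcnj p) p = 1"
    using p X Y XY by (simp_all add: cbil_vcnj_commute[of p X] cbil_vcnj_commute[of p Y]
        cbil_vcnj_commute[of Y X] cnj_cbil[symmetric] cbil_commute[of "vcnj p" p]
        cbil_commute[of p X] cbil_commute[of p Y])
  have "\<forall>i j. cbil (e $ i) (vcnj (e $ j)) = (if i = j then c $ j else 0)"
    unfolding forall_4 e c by (simp add: p X Y XY X' Y' p' vcnj_vcnj)
  moreover have "\<forall>j. c $ j \<noteq> 0"
    unfolding forall_4 c using m by simp
  ultimately have "cbil x y = (\<Sum>j\<in>UNIV. cbil x (vcnj (e $ j)) * cbil (e $ j) y / c $ j)"
    by (intro orthogonal_basis_expansion) auto
  then show ?thesis
    by (simp add: sum_4 e c vcnj_vcnj add_divide_distrib)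
qed

section \<open>Orthogonal projection onto real subspaces\<close>

lemma orth_proj_in: "subspace S \<Longrightarrow> orth_proj S x \<in> S"
  unfolding orth_proj_def using closest_point_in_set[OF closed_subspace] subspace_0 by blast

lemma orth_proj_self: "x \<in> S \<Longrightarrow> orth_proj S x = x"
  by (simp add: orth_proj_def closest_point_self)

text \<open>The variational inequality for the closest point, tested at \<open>?p + n\<close> and
  \<open>?p - n\<close>, gives both signs. Projections thus disappear when paired with a vector of
  the subspace.\<close>

lemma inner_orth_proj:
  assumes S: "subspace S" and n: "n \<in> S"
  shows "n \<bullet> orth_proj S x = n \<bullet> x"
proof -
  let ?p = "orth_proj S x"
  have p: "?p \<in> S" by (rule orth_proj_in[OF S])
  have "(x - ?p) \<bullet> (y - ?p) \<le> 0" if "y \<in> S" for y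
    unfolding orth_proj_def
    by (rule closest_point_dot[OF subspace_imp_convex[OF S] closed_subspace[OF S] that])
  from this[of "?p + n"] this[of "?p - n"] have "(x - ?p) \<bullet> n \<le> 0" "(x - ?p) \<bullet> (- n) \<le> 0"
    using S p n by (simp_all add: subspace_add subspace_diff)
  then show ?thesis
    by (simp add: inner_diff_left inner_diff_right inner_commute)
qed

lemma subspace_horizontal_space: "subspace (horizontal_space p)"
  by (auto simp: subspace_def horizontal_space_def cbil_linear scaleR_eq_scale)
    (simp add: cbil_def)

lemma subspace_Q2_tangent: "subspace (Q2_tangent p)"
  by (auto simp: subspace_def horizontal_space_def Q2_tangent_def cbil_linear scaleR_eq_scale)
    (simp_all add: cbil_def)

lemma subspace_Q2_normal: "subspace (Q2_normal F z)"
  using subspace_Q2_tangent[of "F z"]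
  by (auto simp: subspace_def Q2_normal_def inner_add_left)

section \<open>Minimal Lagrangian surfaces in the quadric\<close>

lemma vdz_eq:
  assumes "F differentiable (at z)"
  shows "vdz F z = (1/2) *s (pdir 1 F z - \<i> *s pdir \<i> F z)"
    "vdzbar F z = (1/2) *s (pdir 1 F z + \<i> *s pdir \<i> F z)"
  using pdir_bounded_linear[OF bounded_linear_vec_nth assms]
  by (simp_all add: vdz_def vdzbar_def dz_def dzbar_def vec_eq_iff)

lemma pdir_eq_vdz_vdzbar:
  assumes "F differentiable (at z)"
  shows "pdir v F z = v *s vdz F z + cnj v *s vdzbar F z"
  unfolding vdz_eq[OF assms] pdir_expand[OF assms, of v]
  by (cases v) (simp add: vec_eq_iff complex_eq_iff field_simps)

lemma pdir_cbil_const: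
  assumes "open D" "z \<in> D" "F differentiable (at z)" "\<And>w. w \<in> D \<Longrightarrow> cbil (F w) (F w) = c"
  shows "cbil (F z) (pdir v F z) = 0"
proof -
  have "pdir v (\<lambda>w. cbil (F w) (F w)) z = cbil (F z) (pdir v F z) + cbil (pdir v F z) (F z)"
    by (rule pdir_eqI[OF bounded_bilinear.FDERIV[OF bounded_bilinear_cbil]])
      (intro has_derivative_pdir assms(3))+
  moreover have "pdir v (\<lambda>w. cbil (F w) (F w)) z = 0"
    by (rule pdir_const_on[OF assms(1,2,4)])
  ultimately show ?thesis
    by (simp add: cbil_commute)
qed

text \<open>Membership is stated through some representative of the line; by homogeneity of
  \<open>cbil\<close> the equation passes to every other one.\<close>

lemma Q2_cbil_zero:
  assumes "cline p \<in> Q2"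
  shows "cbil p p = 0"
proof -
  obtain q where q: "cline p = cline q" "cbil q q = 0"
    using assms by (auto simp: Q2_def)
  have "p \<in> vec.span {q}"
    using q(1) vec.span_base[of p "{p}"] by (simp add: cline_def)
  then obtain k where "p = k *s q"
    by (auto simp: vec.span_singleton)
  then show ?thesis
    using q(2) by (simp add: cbil_linear)
qed

section \<open>Tangential and normal parts of the Laplacian of a lift\<close>

text \<open>Differentiating \<open>|F_x|^2 = |F_y|^2\<close> and \<open>F_x . F_y = 0\<close> gives
  \<open>F_x . F_xx = F_y . F_xy = - F_x . F_yy\<close>, and likewise with \<open>x\<close> and
  \<open>y\<close> exchanged.\<close>

lemma conformal_Laplacian_orthogonal:
  fixes F :: "complex \<Rightarrow> 'b::real_inner"
  assumes D: "open D" "z \<in> D" and F: "smooth_on D F"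
    and conf: "\<And>w. w \<in> D \<Longrightarrow> pdir 1 F w \<bullet> pdir 1 F w = pdir \<i> F w \<bullet> pdir \<i> F w"
      "\<And>w. w \<in> D \<Longrightarrow> pdir 1 F w \<bullet> pdir \<i> F w = 0"
  defines "L \<equiv> pdir 1 (pdir 1 F) z + pdir \<i> (pdir \<i> F) z"
  shows "pdir 1 F z \<bullet> L = 0" "pdir \<i> F z \<bullet> L = 0"
proof -
  have d: "pdir 1 F differentiable (at z)" "pdir \<i> F differentiable (at z)"
    using smooth_onD(2)[OF smooth_onD(3)[OF F] D(2)] smooth_onD(2)[OF smooth_onD(4)[OF F] D(2)]
    by auto
  have 1: "pdir 1 F z \<bullet> pdir v (pdir 1 F) z = pdir \<i> F z \<bullet> pdir v (pdir \<i> F) z" for v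
  proof -
    have "pdir v (\<lambda>w. pdir 1 F w \<bullet> pdir 1 F w) z = pdir v (\<lambda>w. pdir \<i> F w \<bullet> pdir \<i> F w) z"
      using d conf(1)
      by (intro pdir_transform[OF D] differentiable_inner) auto
    then show ?thesis
      using d by (simp add: pdir_inner inner_commute)
  qed
  have 2: "pdir 1 F z \<bullet> pdir v (pdir \<i> F) z + pdir v (pdir 1 F) z \<bullet> pdir \<i> F z = 0" for v
    using pdir_const_on[OF D, of "\<lambda>w. pdir 1 F w \<bullet> pdir \<i> F w" 0 v] conf(2)
    by (simp add: pdir_inner[OF d])
  note sym = pdir_commute[OF D F]
  show "pdir 1 F z \<bullet> L = 0"
    using 1[of 1] 2[of \<i>] sym inner_commute[of "pdir \<i> F z" "pdir 1 (pdir \<i> F) z"]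
    unfolding L_def inner_add_right by simp
  show "pdir \<i> F z \<bullet> L = 0"
    using 1[of \<i>] 2[of 1] sym inner_commute[of "pdir \<i> F z" "pdir 1 (pdir 1 F) z"]
    unfolding L_def inner_add_right by simp
qed

lemma horizontal_lift_pdir:
  assumes "horizontal_lift D f F" "z \<in> D"
  shows "pdir v F z \<in> horizontal_space (F z)" "lift_df F z v = pdir v F z"
proof -
  have "F differentiable (at z)"
    using assms smooth_onD(2) by (auto simp: horizontal_lift_def local_lift_def)
  then show h: "pdir v F z \<in> horizontal_space (F z)"
    using assms by (simp add: pdir_eq_vdz_vdzbar horizontal_space_def cbil_linear horizontal_lift_def)
  show "lift_df F z v = pdir v F z"
    unfolding lift_df_def by (rule orth_proj_self[OF h])
qed

text \<open>In a conformal coordinate the mean curvature vector is a nonzero multiple of the sum of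
  the second fundamental form over \<open>1\<close> and \<open>\<i>\<close>. Pairing with a normal
  \<open>n\<close> removes the three projections, and horizontality removes the connection term,
  which leaves the plain second derivatives.\<close>

lemma minimal_Laplacian_normal:
  assumes lift: "horizontal_lift D f F" and z: "z \<in> D"
    and mc: "mean_curvature_vector F z = 0"
    and conf: "\<And>v w. pullback_metric F z v w = \<rho> * (v \<bullet> w)" and \<rho>: "\<rho> \<noteq> 0"
    and n: "n \<in> Q2_normal F z"
  shows "n \<bullet> (pdir 1 (pdir 1 F) z + pdir \<i> (pdir \<i> F) z) = 0"
proof -
  have D: "open D" and F: "smooth_on D F"
    using lift by (auto simp: horizontal_lift_def local_lift_def)
  have nT: "n \<in> Q2_tangent (F z)" and nH: "n \<in> horizontal_space (F z)"
    using n by (auto simp: Q2_normal_def Q2_tangent_def)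
  have "n \<bullet> second_fundamental_form F z v v = n \<bullet> pdir v (pdir v F) z"
    if "v = 1 \<or> v = \<i>" for v
  proof -
    have "pdir v F differentiable (at z)"
      using smooth_onD(2)[OF smooth_onD(3)[OF F] z] smooth_onD(2)[OF smooth_onD(4)[OF F] z] that
      by auto
    then have "pdir v (\<lambda>z'. lift_df F z' v) z = pdir v (pdir v F) z"
      using horizontal_lift_pdir(2)[OF lift] by (intro pdir_transform[OF D z]) auto
    moreover have "cbil (pdir v F z) (vcnj (F z)) = 0"
      using horizontal_lift_pdir(1)[OF lift z] by (simp add: horizontal_space_def)
    ultimately show ?thesis
      by (simp add: second_fundamental_form_def covariant_derivative_Q2_def
          inner_orth_proj[OF subspace_Q2_normal n] inner_orth_proj[OF subspace_Q2_tangent nT]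
          inner_orth_proj[OF subspace_horizontal_space nH])
  qed
  moreover have "second_fundamental_form F z 1 1 + second_fundamental_form F z \<i> \<i> = 0"
    using mc \<rho> by (simp add: mean_curvature_vector_def Let_def conf inner_complex_def
        scaleR_add_right[symmetric] del: scaleR_add_right)
  ultimately show ?thesis
    by (metis inner_add_right inner_zero_right)
qed


section \<open>The invariants of a horizontal lift\<close>

lemma minimal_Lagrangian_invariants:
  assumes Q2: "f ` D \<subseteq> Q2" and metric: "has_induced_metric D f (\<lambda>z. 2 * exp (u z))"
    and Lagr: "Lagrangian D f" and min: "minimal_in_Q2 D f" and lift: "horizontal_lift D f F"
  shows "alpha_inv F holomorphic_on D"
    "z \<in> D \<Longrightarrow> (cmod (beta_inv F z))\<^sup>2 = exp (2 * u z) - (cmod (alpha_inv F z))\<^sup>2"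
proof -
  have loc: "local_lift f D F" and D: "open D" and F: "smooth_on D F"
    and unit: "\<And>z. z \<in> D \<Longrightarrow> norm (F z) = 1" and fF: "\<And>z. z \<in> D \<Longrightarrow> f z = cline (F z)"
    using lift by (auto simp: horizontal_lift_def local_lift_def)
  have dF: "F differentiable (at z)" if "z \<in> D" for z
    by (rule smooth_onD(2)[OF F that])
  have pull: "pullback_metric F z v w = 2 * exp (u z) * (v \<bullet> w)" if "z \<in> D" for z v w
    using metric loc that unfolding has_induced_metric_def by blast
  \<comment> \<open>The induced metric gives the real part; the Lagrangian condition makes the
    imaginary part zero.\<close>
  have herm: "cbil (pdir v F z) (vcnj (pdir w F z)) = of_real (2 * exp (u z) * (v \<bullet> w))"
    if z: "z \<in> D" for z v w
  proof -
    have "pullback_Kaehler_form F z v w = 0"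
      using Lagr loc z unfolding Lagrangian_def by blast
    then show ?thesis
      using pull[OF z, of v w]
      by (simp add: cbil_vcnj_eq_Complex pullback_Kaehler_form_def pullback_metric_def
          horizontal_lift_pdir(2)[OF lift z] complex_eq_iff)
  qed
  have null: "cbil (F z) (F z) = 0" if "z \<in> D" for z
    using Q2 fF[OF that] that by (intro Q2_cbil_zero) auto
  have dnull: "cbil (F z) (pdir v F z) = 0" if "z \<in> D" for z v
    by (rule pdir_cbil_const[OF D that dF[OF that] null])
  \<comment> \<open>By \<open>herm\<close> the partial derivatives in \<open>x\<close> and
    \<open>y\<close> are Hermitian orthogonal of equal length, so \<open>vdz F z\<close> and
    \<open>vdzbar F z\<close> are orthogonal too, both of squared length
    \<open>exp (u z)\<close>.\<close>
  have frame: "cbil x y = cbil x (vcnj (F z)) * cbil (F z) y + cbil x (F z) * cbil (vcnj (F z)) y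
      + (cbil x (vcnj (vdz F z)) * cbil (vdz F z) y
        + cbil x (vcnj (vdzbar F z)) * cbil (vdzbar F z) y) / of_real (exp (u z))"
    if z: "z \<in> D" for z x y
  proof (rule quadric_frame_expansion)
    show "cbil (F z) (vcnj (F z)) = 1"
    proof -
      have "Im (cbil (F z) (vcnj (F z))) = 0"
        using cbil_vcnj_commute[of "F z" "F z"] by (simp add: complex_eq_iff)
      moreover have "Re (cbil (F z) (vcnj (F z))) = 1"
        using unit[OF z] by (simp add: cbil_vcnj_eq_Complex dot_square_norm)
      ultimately show ?thesis by (simp add: complex_eq_iff)
    qed
    show "cbil (F z) (F z) = 0" by (rule null[OF z])
    show "cbil (vdz F z) (vcnj (F z)) = 0" "cbil (vdzbar F z) (vcnj (F z)) = 0"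
      using lift z by (auto simp: horizontal_lift_def)
    show "cbil (vdz F z) (F z) = 0" "cbil (vdzbar F z) (F z) = 0"
      using dnull[OF z, of 1] dnull[OF z, of \<i>]
      by (simp_all add: vdz_eq[OF dF[OF z]] cbil_linear cbil_commute[of _ "F z"])
    show "cbil (vdz F z) (vcnj (vdz F z)) = of_real (exp (u z))"
      "cbil (vdzbar F z) (vcnj (vdzbar F z)) = of_real (exp (u z))"
      "cbil (vdz F z) (vcnj (vdzbar F z)) = 0"
      by (simp_all add: vdz_eq[OF dF[OF z]] cbil_linear herm[OF z] inner_complex_def)
    show "of_real (exp (u z)) \<noteq> (0::complex)" by simp
  qed
  \<comment> \<open>These products remove the terms along \<open>F\<close> and its conjugate in the
    two expansions below.\<close>
  have zero: "cbil (vcnj (vdz F z)) (vcnj (F z)) = 0" "cbil (F z) (vdz F z) = 0"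
      "cbil (vcnj (F z)) (vdz F z) = 0"
    and norm_vdz: "cbil (vcnj (vdz F z)) (vdz F z) = of_real (exp (u z))"
    if z: "z \<in> D" for z
  proof -
    have X: "cbil (vdz F z) (F z) = 0"
      using dnull[OF z, of 1] dnull[OF z, of \<i>]
      by (simp add: vdz_eq[OF dF[OF z]] cbil_linear cbil_commute[of _ "F z"])
    then show "cbil (vcnj (vdz F z)) (vcnj (F z)) = 0" "cbil (F z) (vdz F z) = 0"
      by (simp_all add: cnj_cbil[symmetric] cbil_commute[of "F z"])
    show "cbil (vcnj (F z)) (vdz F z) = 0"
      using lift z by (auto simp: horizontal_lift_def cbil_commute[of "vcnj (F z)"])
    show "cbil (vcnj (vdz F z)) (vdz F z) = of_real (exp (u z))"
      unfolding cbil_commute[of "vcnj (vdz F z)"]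
      by (simp add: vdz_eq[OF dF[OF z]] cbil_linear herm[OF z] inner_complex_def)
  qed
  show "(cmod (beta_inv F z))\<^sup>2 = exp (2 * u z) - (cmod (alpha_inv F z))\<^sup>2" if z: "z \<in> D"
  proof -
    let ?E = "complex_of_real (exp (u z))"
    \<comment> \<open>This is the squared length of \<open>vdz F z\<close>, expanded in the
      frame.\<close>
    have "?E = (cnj (alpha_inv F z) * alpha_inv F z + cnj (beta_inv F z) * beta_inv F z) / ?E"
      using frame[OF z, of "vcnj (vdz F z)" "vdz F z"]
      by (simp add: zero[OF z] norm_vdz[OF z] alpha_inv_def beta_inv_def cnj_cbil
          cbil_commute[of "vdzbar F z"])
    then have "?E * ?E = cnj (alpha_inv F z) * alpha_inv F z + cnj (beta_inv F z) * beta_inv F z"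
      by (simp add: field_simps)
    also have "\<dots> = of_real ((cmod (alpha_inv F z))\<^sup>2 + (cmod (beta_inv F z))\<^sup>2)"
      by (simp only: of_real_add complex_norm_square mult.commute)
    finally have "exp (u z) * exp (u z) = (cmod (alpha_inv F z))\<^sup>2 + (cmod (beta_inv F z))\<^sup>2"
      by (simp only: of_real_mult[symmetric] of_real_eq_iff)
    then show ?thesis
      by (simp add: exp_add[symmetric])
  qed
  \<comment> \<open>A quarter of the Laplacian is the mixed derivative of \<open>F\<close>, so the
    \<open>z\<close>-bar derivative of \<alpha> is \<open>2 * cbil (L z) (vdz F z)\<close>.\<close>
  define L where "L z = (1/4) *s (pdir 1 (pdir 1 F) z + pdir \<i> (pdir \<i> F) z)" for z
  have Fk: "smooth_on D (\<lambda>w. F w $ k)" for k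
    by (rule smooth_on_bounded_linear[OF D bounded_linear_vec_nth F])
  have dzk: "has_wirtinger (\<lambda>w. vdz F w $ k) (dz (dz (\<lambda>w. F w $ k)) z) (L z $ k) z"
    if z: "z \<in> D" for z k
  proof -
    have "dzbar (dz (\<lambda>w. F w $ k)) z = L z $ k"
      using dzbar_dz_eq_Laplacian[OF D z Fk, of k]
        pdir_pdir_bounded_linear[OF D z bounded_linear_vec_nth dF]
        smooth_onD(2)[OF smooth_onD(3)[OF F] z] smooth_onD(2)[OF smooth_onD(4)[OF F] z]
      by (simp add: L_def field_simps)
    then show ?thesis
      using has_wirtinger_dz_dzbar[OF smooth_onD(2)[OF smooth_on_dz[OF D Fk] z], of k]
      by (simp add: vdz_def)
  qed
  have dalpha: "has_wirtinger (alpha_inv F) (2 * cbil (\<chi> k. dz (dz (\<lambda>w. F w $ k)) z) (vdz F z))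
      (2 * cbil (L z) (vdz F z)) z" if z: "z \<in> D" for z
  proof (rule has_wirtinger_eq_rhs)
    show "has_wirtinger (alpha_inv F)
        (\<Sum>k\<in>UNIV. dz (dz (\<lambda>w. F w $ k)) z * vdz F z $ k + vdz F z $ k * dz (dz (\<lambda>w. F w $ k)) z)
        (\<Sum>k\<in>UNIV. L z $ k * vdz F z $ k + vdz F z $ k * L z $ k) z"
      unfolding alpha_inv_def[abs_def] cbil_def
      by (rule has_wirtinger_sum[OF has_wirtinger_mult[OF dzk[OF z] dzk[OF z]]])
  qed (simp_all add: cbil_def sum_distrib_left sum.distrib algebra_simps)
  have "cbil (L z) (vdz F z) = 0" if z: "z \<in> D" for z
  proof -
    let ?L = "pdir 1 (pdir 1 F) z + pdir \<i> (pdir \<i> F) z"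
    have real: "pdir v F w \<bullet> pdir v' F w = 2 * exp (u w) * (v \<bullet> v')" if "w \<in> D" for v v' w
      using arg_cong[OF herm[OF that], of Re v v'] by (simp add: cbil_vcnj_eq_Complex)
    have tan: "pdir 1 F z \<bullet> ?L = 0" "pdir \<i> F z \<bullet> ?L = 0"
      by (rule conformal_Laplacian_orthogonal[OF D z F]; simp add: real inner_complex_def)+
    have mc: "mean_curvature_vector F z = 0"
      using min loc z unfolding minimal_in_Q2_def by blast
    \<comment> \<open>By the Lagrangian condition multiplication by \<open>\<i>\<close> turns
      tangent vectors of the surface into normal ones, and it preserves the tangent space of the
      quadric.\<close>
    have nor: "(\<i> *s pdir v F z) \<bullet> ?L = 0" for v
    proof (rule minimal_Laplacian_normal[OF lift z mc pull[OF z]])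
      show "\<i> *s pdir v F z \<in> Q2_normal F z"
        using horizontal_lift_pdir[OF lift z] dnull[OF z] arg_cong[OF herm[OF z], of Im v]
        by (simp add: Q2_normal_def Q2_tangent_def horizontal_space_def cbil_linear
            cbil_vcnj_eq_Complex complex_eq_iff)
    qed simp
    \<comment> \<open>\<open>tan\<close> and \<open>nor\<close> are the vanishing of the real and
      imaginary parts.\<close>
    have "cbil (pdir v F z) (vcnj ?L) = 0" if "v = 1 \<or> v = \<i>" for v
      using that
    proof
      assume "v = 1"
      then show ?thesis using tan(1) nor[of 1] by (simp add: cbil_vcnj_eq_Complex Complex_eq_0)
    next
      assume "v = \<i>"
      then show ?thesis using tan(2) nor[of \<i>] by (simp add: cbil_vcnj_eq_Complex Complex_eq_0)
    qed
    from this[of 1] this[of \<i>]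
    have perp: "cbil ?L (vcnj (pdir 1 F z)) = 0" "cbil ?L (vcnj (pdir \<i> F z)) = 0"
      by (simp_all add: cbil_vcnj_commute[of ?L])
    \<comment> \<open>So \<open>L z\<close> lies in the span of \<open>F z\<close> and its
      conjugate, both of which have zero bilinear product with \<open>vdz F z\<close>.\<close>
    have "cbil (L z) (vcnj (vdz F z)) = 0" "cbil (L z) (vcnj (vdzbar F z)) = 0"
      unfolding L_def vdz_eq[OF dF[OF z]] vcnj_scale vcnj_add vcnj_diff cbil_scale_left
        cbil_scale_right cbil_add_right cbil_diff_right perp by simp_all
    then show ?thesis
      using frame[OF z, of "L z" "vdz F z"] by (simp add: zero[OF z])
  qed
  then show "alpha_inv F holomorphic_on D"
    using dalpha by (intro holomorphic_on_dzbar_zero)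
      (auto intro: has_wirtinger_differentiable dest!: has_wirtinger_imp(2))
qed

section \<open>The Gauss equation and the sinh-Gordon equation\<close>

text \<open>
  Below \<open>s\<close>, \<open>t\<close>, \<open>E\<close> stand for \<open>e\<^bsup>uh\<^esup>\<close>, \<open>e\<^bsup>-uh\<^esup>\<close>, \<open>e\<^bsup>u\<^esup>\<close>; \<open>a\<close>, \<open>p\<close> for \<open>\<alpha>\<close>, \<open>\<alpha>\<^sub>z\<close> and
  \<open>a'\<close>, \<open>q\<close> for their conjugates; \<open>w\<close>, \<open>v\<close>, \<open>m\<close> for the \<open>z\<close>, \<open>z\<close>-bar and mixed
  derivatives of \<open>uh\<close>; \<open>X\<close>, \<open>Y\<close>, \<open>M\<close> for those of \<open>E\<close>.
\<close>

lemma Gauss_equation_factorization: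
  fixes a a' p q s t w v m E b X Y M :: complex
  assumes st: "s * t = 1" and E0: "E \<noteq> 0"
    and E: "E = (s + a * a' * t) / 2" and b: "b = (s - a * a' * t) / 2"
    and X: "X = (s * w + p * a' * t - a * a' * t * w) / 2"
    and Y: "Y = (s * v + a * q * t - a * a' * t * v) / 2"
    and M: "M = (s * v * w + s * m + p * q * t - p * a' * t * v
      - a * q * t * w + a * a' * t * v * w - a * a' * t * m) / 2"
  shows "(M * E - X * Y) / E\<^sup>2 * E * b\<^sup>2 - 1/4 * (p * q) * E - (X / E) * (Y / E) * E * (a * a')
     + 1/2 * p * (Y / E) * E * a' + 1/2 * q * (X / E) * E * a + 2 * (b\<^sup>2)\<^sup>2 = b ^ 3 * (m + 2 * b)"
proof -
  have bE: "b\<^sup>2 = E\<^sup>2 - a * a'"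
  proof -
    have "E\<^sup>2 - b\<^sup>2 = a * a' * (s * t)"
      unfolding E b by (simp add: field_simps power2_eq_square)
    then show ?thesis by (simp add: st algebra_simps)
  qed
  \<comment> \<open>The two terms containing \<open>X * Y\<close> combine through
    \<open>b\<^sup>2 + a * a' = E\<^sup>2\<close>, which cancels the denominator
    \<open>E\<close>.\<close>
  have "(M * E - X * Y) / E\<^sup>2 * E * b\<^sup>2 - (X / E) * (Y / E) * E * (a * a')
      = M * b\<^sup>2 - X * Y * (b\<^sup>2 + a * a') / E"
    using E0 by (simp add: field_simps power2_eq_square)
  also have "\<dots> = M * b\<^sup>2 - X * Y * E"
  proof -
    have "b\<^sup>2 + a * a' = E\<^sup>2" by (simp add: bE)
    then show ?thesis
      using E0 by (simp add: power2_eq_square[of E])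
  qed
  finally have "(M * E - X * Y) / E\<^sup>2 * E * b\<^sup>2 - (X / E) * (Y / E) * E * (a * a')
      = M * b\<^sup>2 - X * Y * E" .
  note quotients = this
  \<comment> \<open>Writing \<open>a = s * c\<close> and \<open>p = s * P\<close> uses up the side
    condition \<open>s * t = 1\<close>: what remains is an identity between polynomials in
    independent variables.\<close>
  define c P where "c = a * t" and "P = p * t"
  have ac: "a = s * c" "p = s * P"
    using st by (simp_all add: c_def P_def mult.left_commute)
  define d where "d = c * a'"
  \<comment> \<open>Doubling clears the halves, so the identity has integer coefficients; the common
    factor 8 returns below.\<close>
  define E2 b2 X2 Y2 M2 where "E2 = s + d" and "b2 = s - d" and "X2 = (s - d) * w + P * a'"
    and "Y2 = (s - d) * v + c * q"
    and "M2 = (s + d) * v * w + (s - d) * m + P * q - P * a' * v - c * q * w"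
  note doubled = this
  have halves: "E = E2 / 2" "b = b2 / 2" "X = X2 / 2" "Y = Y2 / 2" "M = M2 / 2"
    unfolding E b X Y M doubled d_def c_def P_def by (simp_all add: algebra_simps)
  have "M2 * b2\<^sup>2 - X2 * Y2 * E2 - s * P * q * E2 + 2 * s * P * a' * Y2 + 2 * q * s * c * X2
      = b2 ^ 3 * m"
    unfolding doubled d_def by (simp add: algebra_simps power2_eq_square power3_eq_cube)
  moreover have "M * b\<^sup>2 - X * Y * E - 1/4 * (p * q) * E + 1/2 * p * Y * a' + 1/2 * q * X * a
      = (M2 * b2\<^sup>2 - X2 * Y2 * E2 - s * P * q * E2 + 2 * s * P * a' * Y2 + 2 * q * s * c * X2) / 8"
    unfolding halves ac
    by (simp add: power_divide add_divide_distrib diff_divide_distrib algebra_simps power2_eq_square)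
  moreover have "b ^ 3 * m = b2 ^ 3 * m / 8"
    by (simp add: halves power_divide)
  ultimately have "M * b\<^sup>2 - X * Y * E - 1/4 * (p * q) * E + 1/2 * p * Y * a' + 1/2 * q * X * a
      = b ^ 3 * m"
    by presburger
  note poly = this
  let ?A = "(M * E - X * Y) / E\<^sup>2 * E * b\<^sup>2" and ?B = "(X / E) * (Y / E) * E * (a * a')"
  have "?A - 1/4 * (p * q) * E - ?B + 1/2 * p * (Y / E) * E * a' + 1/2 * q * (X / E) * E * a
      + 2 * (b\<^sup>2)\<^sup>2
    = (?A - ?B) - 1/4 * (p * q) * E + 1/2 * p * ((Y / E) * E) * a' + 1/2 * q * ((X / E) * E) * a
      + 2 * (b\<^sup>2)\<^sup>2"
    by (simp only: mult.assoc) (simp only: diff_conv_add_uminus add_ac)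
  also have "\<dots> = b ^ 3 * m + 2 * (b\<^sup>2)\<^sup>2"
  proof -
    have "(Y / E) * E = Y" "(X / E) * E = X"
      using E0 by simp_all
    then show ?thesis
      by (simp only: quotients poly)
  qed
  finally show ?thesis
    by (simp add: algebra_simps power2_eq_square power3_eq_cube)
qed


section \<open>Equivalence of the two equations\<close>

text \<open>The geometry enters through holomorphy of \<alpha> and the formula for the modulus of
  \<beta>. The derivatives of \<open>u\<close> are obtained from those of \<open>uh\<close> by
  differentiating \<open>u\<close> as a logarithm.\<close>

lemma Gauss_equation_iff_sinh_Gordon:
  fixes u uh :: "complex \<Rightarrow> real" and \<alpha> \<beta> U Uh :: "complex \<Rightarrow> complex"
  defines "U \<equiv> \<lambda>z. complex_of_real (u z)" and "Uh \<equiv> \<lambda>z. complex_of_real (uh z)"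
  assumes D: "open D" and hol: "\<alpha> holomorphic_on D" and uh: "smooth_on D uh"
    and beta: "\<And>z. z \<in> D \<Longrightarrow> (cmod (\<beta> z))\<^sup>2 = exp (2 * u z) - (cmod (\<alpha> z))\<^sup>2"
    and rel: "\<And>z. z \<in> D \<Longrightarrow> 2 * exp (u z) = exp (uh z) + (cmod (\<alpha> z))\<^sup>2 * exp (- uh z)"
  shows "(\<forall>z\<in>D.
        dzbar (dz U) z * exp (U z) * (cmod (\<beta> z))\<^sup>2
        - 1/4 * (cmod (dz \<alpha> z))\<^sup>2 * exp (U z)
        - (cmod (dz U z))\<^sup>2 * exp (U z) * (cmod (\<alpha> z))\<^sup>2
        + 1/2 * dz \<alpha> z * dzbar U z * exp (U z) * cnj (\<alpha> z)
        + 1/2 * dzbar (\<lambda>w. cnj (\<alpha> w)) z * dz U z * exp (U z) * \<alpha> z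
        + 2 * (cmod (\<beta> z)) ^ 4 = 0)
     \<longleftrightarrow>
     (\<forall>z\<in>D. dzbar (dz Uh) z + exp (Uh z) - (cmod (\<alpha> z))\<^sup>2 * exp (- Uh z) = 0)"
    (is "(\<forall>z\<in>D. ?G z = 0) \<longleftrightarrow> (\<forall>z\<in>D. ?S z = 0)")
proof -
  define s t where "s z = exp (Uh z)" and "t z = exp (- Uh z)" for z
  define A where "A z = \<alpha> z * cnj (\<alpha> z)" for z
  \<comment> \<open>On \<open>D\<close>, \<open>E\<close> is \<open>exp (U z)\<close>, and
    \<open>b\<close> is a real number of either sign with the same square as the modulus of
    \<beta>.\<close>
  define E b where "E z = (s z + A z * t z) / 2" and "b z = (s z - A z * t z) / 2" for z
  have st: "s z * t z = 1" for z
    by (simp add: s_def t_def exp_minus)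
  have cmod_sq: "(complex_of_real (cmod x))\<^sup>2 = x * cnj x" for x
    by (simp only: complex_norm_square flip: of_real_power)
  have A: "(complex_of_real (cmod (\<alpha> z)))\<^sup>2 = A z" for z
    by (simp only: A_def cmod_sq)
  have expU: "exp (U z) = E z" if "z \<in> D" for z
  proof -
    have "2 * exp (U z) = complex_of_real (2 * exp (u z))"
      by (simp add: U_def exp_of_real)
    also have "\<dots> = s z + A z * t z"
      unfolding rel[OF that] by (simp add: A s_def t_def Uh_def exp_of_real[symmetric])
    finally show ?thesis by (simp add: E_def mult.commute)
  qed
  have E0: "E z \<noteq> 0" if "z \<in> D" for z
    using expU[OF that] by (metis exp_not_eq_zero)

  have sUh: "smooth_on D Uh"
    unfolding Uh_def by (rule smooth_on_bounded_linear[OF D bounded_linear_of_real uh])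
  define m where "m z = dzbar (dz Uh) z" for z
  have dUh: "has_wirtinger Uh (dz Uh z) (dzbar Uh z) z" if "z \<in> D" for z
    by (rule has_wirtinger_dz_dzbar[OF smooth_onD(2)[OF sUh that]])
  have ddUh: "has_wirtinger (dz Uh) (dz (dz Uh) z) (m z) z" if "z \<in> D" for z
    unfolding m_def by (rule has_wirtinger_dz_dzbar[OF smooth_onD(2)[OF smooth_on_dz[OF D sUh] that]])
  have cont_m: "continuous_on D m"
    unfolding m_def by (rule smooth_onD(1)[OF smooth_on_dzbar[OF D smooth_on_dz[OF D sUh]]])
  have cnj_dzUh: "dzbar Uh z = cnj (dz Uh z)" if "z \<in> D" for z
    unfolding Uh_def by (rule dzbar_of_real[OF smooth_onD(2)[OF uh that]])
  define p where "p = deriv \<alpha>"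
  have d\<alpha>: "has_wirtinger \<alpha> (p z) 0 z" if "z \<in> D" for z
    unfolding p_def by (rule has_wirtinger_holomorphic[OF hol D that])
  have dp: "has_wirtinger p (deriv p z) 0 z" if "z \<in> D" for z
    unfolding p_def
    by (rule has_wirtinger_holomorphic[OF holomorphic_deriv[OF hol D] D that])
  have ds: "has_wirtinger s (s z * dz Uh z) (s z * dzbar Uh z) z" if "z \<in> D" for z
    unfolding s_def[abs_def] by (rule has_wirtinger_exp[OF dUh[OF that]])
  have dt: "has_wirtinger t (- t z * dz Uh z) (- t z * dzbar Uh z) z" if "z \<in> D" for z
    unfolding t_def[abs_def]
    using has_wirtinger_exp[OF has_wirtinger_diff[OF has_wirtinger_const[of 0] dUh[OF that]]] by simp
  have dA: "has_wirtinger A (p z * cnj (\<alpha> z)) (\<alpha> z * cnj (p z)) z" if "z \<in> D" for z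
    unfolding A_def[abs_def]
    using has_wirtinger_mult[OF d\<alpha>[OF that] has_wirtinger_cnj[OF d\<alpha>[OF that]]] by simp
  \<comment> \<open>The \<open>z\<close>, \<open>z\<close>-bar and mixed derivatives of
    \<open>E\<close>, in the shape expected by \<open>Gauss_equation_factorization\<close>.\<close>
  define X Y M where
    "X z = (s z * dz Uh z + p z * cnj (\<alpha> z) * t z - A z * t z * dz Uh z) / 2"
    and "Y z = (s z * dzbar Uh z + \<alpha> z * cnj (p z) * t z - A z * t z * dzbar Uh z) / 2"
    and "M z = (s z * dzbar Uh z * dz Uh z + s z * m z + p z * cnj (p z) * t z
      - p z * cnj (\<alpha> z) * t z * dzbar Uh z - \<alpha> z * cnj (p z) * t z * dz Uh z
      + A z * t z * dzbar Uh z * dz Uh z - A z * t z * m z) / 2" for z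
  have dE: "has_wirtinger E (X z) (Y z) z" if z: "z \<in> D" for z
    unfolding E_def[abs_def] divide_inverse
    by (rule has_wirtinger_eq_rhs,
        (rule has_wirtinger_mult has_wirtinger_add has_wirtinger_const ds dt dA z)+)
      (simp_all add: X_def Y_def field_simps)
  \<comment> \<open>Only the \<open>z\<close>-bar coefficient is needed; the other one is left to
    unification.\<close>
  have dX: "\<exists>P. has_wirtinger X P (M z) z" if z: "z \<in> D" for z
    unfolding X_def[abs_def] divide_inverse
    by (rule exI, rule has_wirtinger_eq_rhs,
        (rule has_wirtinger_mult has_wirtinger_diff has_wirtinger_add has_wirtinger_const
          has_wirtinger_cnj ds dt dA dp d\<alpha> ddUh z)+)
      (rule refl, simp add: M_def field_simps)
  \<comment> \<open>\<open>E z\<close> is a positive real, hence off the branch cut, and the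
    principal logarithm recovers \<open>u\<close>.\<close>
  have Ln: "U z = Ln (E z)" if "z \<in> D" for z
    using expU[OF that] by (simp add: U_def Ln_unique exp_of_real[symmetric] Ln_of_real)
  have dU: "has_wirtinger U (X z / E z) (Y z / E z) z" if z: "z \<in> D" for z
  proof -
    have "E z \<notin> \<real>\<^sub>\<le>\<^sub>0"
      unfolding expU[OF z, symmetric] U_def exp_of_real by (simp add: complex_nonpos_Reals_iff)
    then have "has_wirtinger (\<lambda>w. Ln (E w)) (inverse (E z) * X z) (inverse (E z) * Y z) z"
      by (intro has_wirtinger_compose_holomorphic[OF dE[OF z]] has_field_derivative_Ln)
    then have "has_wirtinger U (inverse (E z) * X z) (inverse (E z) * Y z) z"
      by (rule has_wirtinger_transform[OF _ D z]) (simp add: Ln)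
    then show ?thesis
      by (simp add: divide_inverse mult.commute)
  qed
  have ddU: "dzbar (dz U) z = (M z * E z - X z * Y z) / (E z)\<^sup>2" if z: "z \<in> D" for z
  proof -
    obtain P where P: "has_wirtinger X P (M z) z"
      using dX[OF z] by blast
    have "has_wirtinger (\<lambda>w. inverse (E w)) (- inverse ((E z)\<^sup>2) * X z) (- inverse ((E z)\<^sup>2) * Y z) z"
      by (rule has_wirtinger_compose_holomorphic[OF dE[OF z]])
        (use E0[OF z] in \<open>auto intro!: derivative_eq_intros simp: power2_eq_square\<close>)
    from has_wirtinger_mult[OF P this]
    have "has_wirtinger (dz U) (P * inverse (E z) + X z * (- inverse ((E z)\<^sup>2) * X z))
        (M z * inverse (E z) + X z * (- inverse ((E z)\<^sup>2) * Y z)) z"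
      by (rule has_wirtinger_transform[OF _ D z])
        (use has_wirtinger_imp(1)[OF dU] in \<open>simp add: divide_inverse\<close>)
    from has_wirtinger_imp(2)[OF this] show ?thesis
      using E0[OF z] by (simp add: field_simps power2_eq_square)
  qed
  have b2: "(b z)\<^sup>2 = (E z)\<^sup>2 - A z" for z
  proof -
    have "(E z)\<^sup>2 - (b z)\<^sup>2 = A z * (s z * t z)"
      unfolding E_def b_def by (simp add: field_simps power2_eq_square)
    then show ?thesis by (simp add: st algebra_simps)
  qed
  have G: "?G z = b z ^ 3 * (m z + 2 * b z)" if z: "z \<in> D" for z
  proof -
    have \<beta>: "(complex_of_real (cmod (\<beta> z)))\<^sup>2 = (b z)\<^sup>2"
    proof -
      have "(complex_of_real (cmod (\<beta> z)))\<^sup>2 = exp (U z) * exp (U z) - A z"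
        unfolding of_real_power[symmetric] beta[OF z]
        by (simp add: A U_def exp_of_real[symmetric] exp_add[symmetric])
      then show ?thesis by (simp only: b2 expU[OF z] power2_eq_square[of "E z"])
    qed
    \<comment> \<open>\<open>U\<close> is real-valued, so conjugation fixes it and interchanges its
      two derivatives up to conjugation.\<close>
    have cnj_dzU: "cnj (dz U z) = dzbar U z"
    proof -
      have "has_wirtinger U (cnj (Y z / E z)) (cnj (X z / E z)) z"
        using has_wirtinger_cnj[OF dU[OF z]] by (simp add: U_def)
      then show ?thesis
        using has_wirtinger_imp[OF dU[OF z]] has_wirtinger_imp(2) by metis
    qed
    have "?G z = dzbar (dz U) z * E z * (b z)\<^sup>2 - 1/4 * (p z * cnj (p z)) * E z
        - dz U z * dzbar U z * E z * A z + 1/2 * p z * dzbar U z * E z * cnj (\<alpha> z)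
        + 1/2 * cnj (p z) * dz U z * E z * \<alpha> z + 2 * ((b z)\<^sup>2)\<^sup>2"
    proof -
      have "(complex_of_real (cmod (\<beta> z))) ^ 4 = ((b z)\<^sup>2)\<^sup>2"
        unfolding \<beta>[symmetric] by (simp flip: power_mult)
      then show ?thesis
        using has_wirtinger_imp(2)[OF has_wirtinger_cnj[OF d\<alpha>[OF z]]]
          has_wirtinger_imp(1)[OF d\<alpha>[OF z]] \<beta> A[of z] cnj_dzU
        by (simp only: expU[OF z] of_real_power of_real_mult of_real_divide of_real_numeral of_real_1
            cmod_sq[of "dz U z"] cmod_sq[of "p z"])
    qed
    also have "\<dots> = b z ^ 3 * (m z + 2 * b z)"
      unfolding ddU[OF z] has_wirtinger_imp[OF dU[OF z]] A_def
      by (rule Gauss_equation_factorization[OF st E0[OF z]])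
        (simp_all add: E_def b_def X_def Y_def M_def A_def)
    finally show ?thesis .
  qed
  have S: "?S z = m z + 2 * b z" for z
    unfolding m_def b_def s_def t_def by (simp add: A)
  show ?thesis
  proof
    assume "\<forall>z\<in>D. ?S z = 0"
    then have zero: "m z + 2 * b z = 0" if "z \<in> D" for z
      using that unfolding S by blast
    show "\<forall>z\<in>D. ?G z = 0"
    proof
      fix z assume z: "z \<in> D"
      show "?G z = 0" unfolding G[OF z] zero[OF z] by simp
    qed
  next
    assume *: "\<forall>z\<in>D. ?G z = 0"
    have prod: "b z = 0 \<or> m z + 2 * b z = 0" if "z \<in> D" for z
      using bspec[OF * that] unfolding G[OF that] by simp
    show "\<forall>z\<in>D. ?S z = 0"
    proof (rule ballI, rule ccontr)
      fix z assume z: "z \<in> D" and "?S z \<noteq> 0"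
      then have ne: "m z + 2 * b z \<noteq> 0" unfolding S by blast
      \<comment> \<open>The set where the sinh-Gordon equation fails; it is open, and by
        \<open>prod\<close> the function \<open>b\<close> vanishes on it.\<close>
      define V where "V = {w \<in> D. m w + 2 * b w \<noteq> 0}"
      have zV: "z \<in> V" using z ne by (simp add: V_def)
      have "continuous_on D b"
        unfolding b_def s_def t_def A_def
        by (intro continuous_intros smooth_onD(1)[OF sUh] holomorphic_on_imp_continuous_on[OF hol]) auto
      then have "open (D \<inter> (\<lambda>w. m w + 2 * b w) -` (- {0}))"
        by (intro continuous_open_preimage D open_Compl closed_singleton continuous_intros cont_m)
      then have V: "open V"
        by (simp add: V_def vimage_def Int_def)
      have VD: "w \<in> D" if "w \<in> V" for w using that by (simp add: V_def)
      have bV: "b w = 0" if "w \<in> V" for w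
        using prod[OF VD[OF that]] that by (simp add: V_def)
      \<comment> \<open>On \<open>V\<close>, \<open>b = 0\<close> means that
        \<open>exp (2 * uh)\<close> equals the squared modulus of \<alpha>. This is half the
        logarithmic \<open>z\<close>-derivative of that relation, multiplied out.\<close>
      have log: "2 * (\<alpha> w * dz Uh w) = p w" if w: "w \<in> V" for w
      proof -
        have "has_wirtinger b ((s w * dz Uh w - (p w * cnj (\<alpha> w) * t w - A w * t w * dz Uh w)) / 2)
            ((s w * dzbar Uh w - (\<alpha> w * cnj (p w) * t w - A w * t w * dzbar Uh w)) / 2) w"
          unfolding b_def[abs_def] divide_inverse
          by (rule has_wirtinger_eq_rhs,
              (rule has_wirtinger_mult has_wirtinger_diff has_wirtinger_const ds dt dA VD[OF w])+)
            (simp_all add: field_simps)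
        moreover have "has_wirtinger b 0 0 w"
          by (rule has_wirtinger_transform[OF has_wirtinger_const[of 0] V w]) (simp add: bV)
        ultimately have "s w * dz Uh w - (p w * cnj (\<alpha> w) * t w - A w * t w * dz Uh w) = 0"
          using has_wirtinger_unique(1) by fastforce
        moreover have sA: "s w = A w * t w"
          using bV[OF w] by (simp add: b_def)
        ultimately have "cnj (\<alpha> w) * t w * (2 * (\<alpha> w * dz Uh w) - p w) = 0"
          by (simp add: A_def algebra_simps)
        moreover have "cnj (\<alpha> w) * t w \<noteq> 0"
          using sA st[of w] by (auto simp: A_def)
        ultimately show ?thesis by simp
      qed
      \<comment> \<open>The \<open>z\<close>-bar derivative of \<open>log\<close>: since
        \<open>p\<close> is holomorphic, \<open>2 * (\<alpha> z * m z)\<close> must vanish. As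
        \<alpha> has no zero on \<open>V\<close>, \<open>m z = 0\<close>, which with
        \<open>b z = 0\<close> contradicts the choice of \<open>z\<close>.\<close>
      have "has_wirtinger (\<lambda>w. 2 * (\<alpha> w * dz Uh w))
          (2 * (p z * dz Uh z + \<alpha> z * dz (dz Uh) z)) (2 * (\<alpha> z * m z)) z"
        by (rule has_wirtinger_eq_rhs,
            (rule has_wirtinger_mult has_wirtinger_const d\<alpha> ddUh z)+) simp_all
      then have "has_wirtinger p (2 * (p z * dz Uh z + \<alpha> z * dz (dz Uh) z)) (2 * (\<alpha> z * m z)) z"
        by (rule has_wirtinger_transform[OF _ V zV]) (rule log)
      then have "\<alpha> z * m z = 0"
        using has_wirtinger_unique(2)[OF dp[OF z]] by fastforce
      moreover have "\<alpha> z \<noteq> 0"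
        using bV[OF zV] st[of z] by (auto simp: b_def A_def)
      ultimately show False
        using ne bV[OF zV] by simp
    qed
  qed
qed

theorem proposition1p7:
  fixes D :: "complex set"
    and f :: "complex \<Rightarrow> (complex ^ 4) set"
    and F :: "complex \<Rightarrow> complex ^ 4"
    and u uh :: "complex \<Rightarrow> real"
    and \<alpha> \<beta> U Uh :: "complex \<Rightarrow> complex"
  assumes "open D" and "connected D" and "simply_connected D"
    and "f ` D \<subseteq> Q2"
    and "conformal_immersion D f"
    and "has_induced_metric D f (\<lambda>z. 2 * exp (u z))"
    and "Lagrangian D f"
    and "minimal_in_Q2 D f"
    and "normalized_horizontal_lift D f F"
    and "smooth_on D uh"
  defines "\<alpha> \<equiv> alpha_inv F" and "\<beta> \<equiv> beta_inv F"
    and "U \<equiv> \<lambda>z. complex_of_real (u z)" and "Uh \<equiv> \<lambda>z. complex_of_real (uh z)"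
  assumes "\<forall>z\<in>D. 2 * exp (u z) = exp (uh z) + (cmod (\<alpha> z))\<^sup>2 * exp (- uh z)"
  shows
    "(\<forall>z\<in>D.
        dzbar (dz U) z * exp (U z) * (cmod (\<beta> z))\<^sup>2
        - 1/4 * (cmod (dz \<alpha> z))\<^sup>2 * exp (U z)
        - (cmod (dz U z))\<^sup>2 * exp (U z) * (cmod (\<alpha> z))\<^sup>2
        + 1/2 * dz \<alpha> z * dzbar U z * exp (U z) * cnj (\<alpha> z)
        + 1/2 * dzbar (\<lambda>w. cnj (\<alpha> w)) z * dz U z * exp (U z) * \<alpha> z
        + 2 * (cmod (\<beta> z)) ^ 4 = 0)
     \<longleftrightarrow>
     (\<forall>z\<in>D. dzbar (dz Uh) z + exp (Uh z) - (cmod (\<alpha> z))\<^sup>2 * exp (- Uh z) = 0)"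
proof -
  have lift: "horizontal_lift D f F"
    using assms(9) by (simp add: normalized_horizontal_lift_def)
  note invariants = minimal_Lagrangian_invariants[OF assms(4,6-8) lift]
  show ?thesis
    unfolding \<alpha>_def \<beta>_def U_def Uh_def
    by (rule Gauss_equation_iff_sinh_Gordon[OF assms(1) invariants(1) assms(10) invariants(2)])
      (use assms(15) in \<open>simp_all add: \<alpha>_def\<close>)
qed

end
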